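(* Let $\Phi_1,\Phi_2,\Phi_3$ be Young functions such that $$\Phi_1^{-1}(x)\,\Phi_2^{-1}(x)\le \Phi_3^{-1}(x),\qquad x\ge 0.$$ If $\mu\in M(\mathbb R)$ (a finite regular Borel measure on $\mathbb R$) and $M(\xi)=\hat\mu(\xi)$, then $M\in\tilde{\mathcal M}_{(\Phi_1,\Phi_2,\Phi_3)}(\mathbb R)$. Moreover $$\|M\|_{(\Phi_1,\Phi_2,\Phi_3)}\le 2\|\mu\|_1,$$ where $\|\mu\|_1$ is the total variation of $\mu$.
   Context: A Young function is a function $\Phi:\mathbb R\to[0,\infty]$, not identically zero, which is convex, even and satisfies $\Phi(0)=0$. For $y\ge 0$, $\Phi^{-1}(y)=\inf\{x>0:\Phi(x)>y\}$ (with $\inf\emptyset=\infty$). The Orlicz space $L^\Phi(\mathbb R)$ consists of the measurable $f:\mathbb R\to\mathbb C$ (modulo a.e. equality) with $\int_{\mathbb R}\Phi(|f(x)|/\lambda)\,dx<\infty$ for some $\lambda>0$, with the Luxemburg norm $N_\Phi(f)=\inf\{\lambda>0:\int_{\mathbb R}\Phi(|f(x)|/\lambda)\,dx\le 1\}$. The Fourier transform is $\hat f(\xi)=\int_{\mathbb R}f(x)e^{-2\pi i x\xi}\,dx$ for functions and $\hat\mu(\xi)=\int_{\mathbb R}e^{-2\pi i x\xi}\,d\mu(x)$ for measures, and $\mathcal P(\mathbb R)$ is the set of $f\in L^1(\mathbb R)$ such that $\operatorname{supp}\hat f$ is compact. $\tilde{\mathcal M}_{(\Phi_1,\Phi_2,\Phi_3)}(\mathbb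 R)$ is the space of locally integrable functions $M:\mathbb R\to\mathbb C$ for which there is a constant $C>0$ such that the bilinear map $$B_M(f,g)(x)=\int_{\mathbb R}\int_{\mathbb R}\hat f(\xi)\hat g(\eta)M(\xi-\eta)e^{2\pi i(\xi+\eta)x}\,d\xi\,d\eta$$ satisfies $N_{\Phi_3}(B_M(f,g))\le C\,N_{\Phi_1}(f)N_{\Phi_2}(g)$ for all $f,g\in\mathcal P(\mathbb R)$; $\|M\|_{(\Phi_1,\Phi_2,\Phi_3)}$ is the infimum of such constants $C$. *)

theory Defs
  imports "HOL-Analysis.Analysis"
begin

text \<open>Convexity of an extended-valued function is written out, because \<^const>\<open>convex_on\<close> is
  only available for real-valued functions.  In \<^typ>\<open>ennreal\<close> we have \<open>0 * \<infinity> = 0\<close>, so the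
  inequality is trivial for \<open>t = 0\<close> and \<open>t = 1\<close>, as it should be.\<close>

definition young_function :: "(real \<Rightarrow> ennreal) \<Rightarrow> bool" where
  "young_function \<Phi> \<longleftrightarrow>
     (\<exists>x. \<Phi> x \<noteq> 0) \<and>
     (\<forall>x y t. 0 \<le> t \<and> t \<le> 1 \<longrightarrow>
        \<Phi> ((1 - t) * x + t * y) \<le> ennreal (1 - t) * \<Phi> x + ennreal t * \<Phi> y) \<and>
     (\<forall>x. \<Phi> (- x) = \<Phi> x) \<and>
     \<Phi> 0 = 0"

definition young_inverse :: "(real \<Rightarrow> ennreal) \<Rightarrow> real \<Rightarrow> ennreal" where
  "young_inverse \<Phi> y = Inf (ennreal ` {x. 0 < x \<and> ennreal y < \<Phi> x})"

text \<open>The value is \<open>\<infinity>\<close> if no \<open>c\<close> is admissible, which for measurable \<open>f\<close> means precisely that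
  \<open>f\<close> is not in the Orlicz space of \<open>\<Phi>\<close>.\<close>

definition luxemburg_norm :: "(real \<Rightarrow> ennreal) \<Rightarrow> (real \<Rightarrow> complex) \<Rightarrow> ennreal" where
  "luxemburg_norm \<Phi> f =
     Inf (ennreal ` {c. 0 < c \<and> (\<integral>\<^sup>+ x. \<Phi> (norm (f x) / c) \<partial>lebesgue) \<le> 1})"

definition fourier :: "(real \<Rightarrow> complex) \<Rightarrow> real \<Rightarrow> complex" where
  "fourier f \<xi> = (LINT x|lebesgue. f x * cis (- 2 * pi * x * \<xi>))"

definition band_limited :: "(real \<Rightarrow> complex) set" where
  "band_limited = {f. integrable lebesgue f \<and> compact (closure {\<xi>. fourier f \<xi> \<noteq> 0})}"

definition bilinear_multiplier ::
  "(real \<Rightarrow> complex) \<Rightarrow> (real \<Rightarrow> complex) \<Rightarrow> (real \<Rightarrow> complex) \<Rightarrow> real \<Rightarrow> complex" where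
  "bilinear_multiplier M f g x =
     (LINT \<eta>|lebesgue. LINT \<xi>|lebesgue.
        fourier f \<xi> * fourier g \<eta> * M (\<xi> - \<eta>) * cis (2 * pi * (\<xi> + \<eta>) * x))"

definition multiplier_bound ::
  "(real \<Rightarrow> ennreal) \<Rightarrow> (real \<Rightarrow> ennreal) \<Rightarrow> (real \<Rightarrow> ennreal) \<Rightarrow> (real \<Rightarrow> complex) \<Rightarrow> real \<Rightarrow> bool"
  where
  "multiplier_bound \<Phi>1 \<Phi>2 \<Phi>3 M C \<longleftrightarrow>
     0 < C \<and>
     (\<forall>f\<in>band_limited. \<forall>g\<in>band_limited.
        luxemburg_norm \<Phi>3 (bilinear_multiplier M f g)
          \<le> ennreal C * luxemburg_norm \<Phi>1 f * luxemburg_norm \<Phi>2 g)"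

definition multiplier_space ::
  "(real \<Rightarrow> ennreal) \<Rightarrow> (real \<Rightarrow> ennreal) \<Rightarrow> (real \<Rightarrow> ennreal) \<Rightarrow> (real \<Rightarrow> complex) set" where
  "multiplier_space \<Phi>1 \<Phi>2 \<Phi>3 =
     {M. (\<forall>K. compact K \<longrightarrow> M absolutely_integrable_on K) \<and>
         (\<exists>C. multiplier_bound \<Phi>1 \<Phi>2 \<Phi>3 M C)}"

definition multiplier_norm ::
  "(real \<Rightarrow> ennreal) \<Rightarrow> (real \<Rightarrow> ennreal) \<Rightarrow> (real \<Rightarrow> ennreal) \<Rightarrow> (real \<Rightarrow> complex) \<Rightarrow> ennreal" where
  "multiplier_norm \<Phi>1 \<Phi>2 \<Phi>3 M = Inf (ennreal ` {C. multiplier_bound \<Phi>1 \<Phi>2 \<Phi>3 M C})"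

text \<open>A complex measure is a set function; only its values on Borel sets matter.\<close>

definition total_variation :: "(real set \<Rightarrow> complex) \<Rightarrow> real set \<Rightarrow> ennreal" where
  "total_variation \<mu> A =
     (SUP E \<in> {E :: nat \<Rightarrow> real set. range E \<subseteq> sets borel \<and> disjoint_family E \<and> (\<Union>i. E i) = A}.
        \<Sum>i. ennreal (norm (\<mu> (E i))))"

text \<open>Finiteness of the total variation is a consequence of countable additivity.\<close>

definition regular_complex_measure :: "(real set \<Rightarrow> complex) \<Rightarrow> bool" where
  "regular_complex_measure \<mu> \<longleftrightarrow>
     (\<forall>E :: nat \<Rightarrow> real set. range E \<subseteq> sets borel \<and> disjoint_family E \<longrightarrow>
        (\<lambda>i. \<mu> (E i)) sums \<mu> (\<Union>i. E i)) \<and>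
     (\<forall>A \<in> sets borel. \<forall>e > 0. \<exists>K U.
        compact K \<and> open U \<and> K \<subseteq> A \<and> A \<subseteq> U \<and> total_variation \<mu> (U - K) < ennreal e)"

text \<open>The positive part of the Jordan decomposition of a finite signed Borel measure \<open>\<nu>\<close> is
  \<open>\<nu>\<^sup>+ A = sup {\<nu> B | B \<subseteq> A Borel}\<close>, and the negative part is the positive part of \<open>- \<nu>\<close>.
  The coercion \<^const>\<open>ennreal\<close> truncates negative values to \<open>0\<close>, which does not affect the
  supremum since \<open>B = {}\<close> contributes \<open>0\<close>.\<close>

definition positive_part :: "(real set \<Rightarrow> real) \<Rightarrow> real measure" where
  "positive_part \<nu> =
     measure_of UNIV (sets borel) (\<lambda>A. SUP B \<in> {B \<in> sets borel. B \<subseteq> A}. ennreal (\<nu> B))"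

definition signed_integral :: "(real set \<Rightarrow> real) \<Rightarrow> (real \<Rightarrow> complex) \<Rightarrow> complex" where
  "signed_integral \<nu> f =
     integral\<^sup>L (positive_part \<nu>) f - integral\<^sup>L (positive_part (\<lambda>A. - \<nu> A)) f"

definition complex_integral :: "(real set \<Rightarrow> complex) \<Rightarrow> (real \<Rightarrow> complex) \<Rightarrow> complex" where
  "complex_integral \<mu> f =
     signed_integral (\<lambda>A. Re (\<mu> A)) f + \<i> * signed_integral (\<lambda>A. Im (\<mu> A)) f"

definition fourier_measure :: "(real set \<Rightarrow> complex) \<Rightarrow> real \<Rightarrow> complex" where
  "fourier_measure \<mu> \<xi> = complex_integral \<mu> (\<lambda>x. cis (- 2 * pi * x * \<xi>))"

end

theory Submission
  imports Defs "HOL-Probability.Characteristic_Functions"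
begin

text \<open>
  If \<open>M\<close> is the Fourier transform of \<open>\<mu>\<close>, then inserting \<open>M (\<xi> - \<eta>) = \<integral> exp(- 2 \<pi> i t (\<xi> - \<eta>)) d\<mu>(t)\<close> into
  the operator and integrating over \<open>\<xi>\<close> and \<open>\<eta>\<close> first gives, by Fourier inversion,
  \<open>B\<^sub>M(f, g)(x) = \<integral> f(x - t) g(x + t) d\<mu>(t)\<close>: an average over \<open>t\<close> of products of translates
  (\<open>band_limited_inversion\<close>, \<open>bilinear_multiplier_fourier_transform\<close>).

  Each product obeys the Orlicz form of Hoelder's inequality.  The condition on the inverses gives
  \<open>\<Phi>3 s \<le> \<Phi>1 u + \<Phi>2 v\<close> whenever \<open>0 \<le> s < u v\<close> (\<open>young_product_le\<close>), and halving the argument makes the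
  modular of a product at most \<open>1\<close> when both modulars are; this is the source of the constant \<open>2\<close>.
  Averages are controlled by Jensen's inequality (\<open>young_Jensen\<close>), and since Lebesgue measure is invariant
  under translation, the bound does not depend on \<open>t\<close>.  Hence the operator norm is at most twice the mass
  of \<open>\<bar>\<mu>\<bar>\<close> (\<open>luxemburg_norm_bilinear_average_le\<close>).

  A Young function may jump to \<open>\<infinity>\<close>.  It may fail to be left-continuous there, so the product bound
  stops short of \<open>s = u v\<close>; and it may lack a supporting line there, so Jensen's inequality is used
  strictly below the mean.  Each costs a factor \<open>\<rho> < 1\<close>, which is removed in the limit.

  The measure enters through a density: \<open>\<mu> = h L\<close> with a finite positive measure \<open>L\<close>
  (\<open>complex_measure_density\<close>), and the integral of \<open>\<bar>h\<bar>\<close> is at most the total variation of \<open>\<mu>\<close>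
  (\<open>integral_norm_density_le_total_variation\<close>).  This needs \<open>\<mu>\<close> to be bounded, which follows
  from regularity and compactness (\<open>regular_complex_measure_bounded\<close>).
\<close>

section \<open>Young functions and Luxemburg norms\<close>

lemma young_scale:
  assumes "young_function \<Phi>" "0 \<le> t" "t \<le> 1"
  shows "\<Phi> (t * x) \<le> ennreal t * \<Phi> x"
proof -
  have *: "\<forall>x y t. 0 \<le> t \<and> t \<le> 1 \<longrightarrow>
        \<Phi> ((1 - t) * x + t * y) \<le> ennreal (1 - t) * \<Phi> x + ennreal t * \<Phi> y" "\<Phi> 0 = 0"
    using assms(1) unfolding young_function_def by blast+
  show ?thesis using *(1)[rule_format, of t 0 x] *(2) assms by simp
qed

lemma young_mono:
  assumes "young_function \<Phi>" "0 \<le> x" "x \<le> y"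
  shows "\<Phi> x \<le> \<Phi> y"
proof (cases "y = 0")
  case False
  then have y: "0 < y" using assms by simp
  have "\<Phi> x = \<Phi> ((x / y) * y)" using y by simp
  also have "\<dots> \<le> ennreal (x / y) * \<Phi> y"
    by (rule young_scale) (use assms y in auto)
  also have "\<dots> \<le> 1 * \<Phi> y"
    using assms y by (intro mult_right_mono) auto
  finally show ?thesis by simp
qed (use assms in auto)

lemma young_abs: "young_function \<Phi> \<Longrightarrow> \<Phi> \<bar>x\<bar> = \<Phi> x"
  by (auto simp: young_function_def abs_if)

text \<open>Sublevel sets of a Young function are intervals, because the function is even and increases
  away from \<open>0\<close>.\<close>

lemma young_borel [measurable (raw)]:
  assumes "young_function \<Phi>"
  shows "\<Phi> \<in> borel_measurable borel"
proof (rule borel_measurableI_le)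
  fix y
  have "is_interval {x. \<Phi> x \<le> y}"
    unfolding is_interval_1
  proof (intro allI ballI impI, clarify)
    fix a b x assume ab: "\<Phi> a \<le> y" "\<Phi> b \<le> y" "a \<le> x" "x \<le> b"
    have "\<bar>x\<bar> \<le> \<bar>a\<bar> \<or> \<bar>x\<bar> \<le> \<bar>b\<bar>" using ab by arith
    then show "\<Phi> x \<le> y"
      using ab young_mono[OF assms, of "\<bar>x\<bar>" "\<bar>a\<bar>"] young_mono[OF assms, of "\<bar>x\<bar>" "\<bar>b\<bar>"]
      by (auto simp: young_abs[OF assms])
  qed
  then show "{x \<in> space borel. \<Phi> x \<le> y} \<in> sets borel"
    by (simp add: real_interval_borel_measurable)
qed

lemma young_comp_borel [measurable]:
  assumes "young_function \<Phi>" "f \<in> borel_measurable N"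
  shows "(\<lambda>x. \<Phi> (f x)) \<in> borel_measurable N"
  using young_borel[OF assms(1)] assms(2) by measurable

text \<open>This is where the hypothesis on the inverses is used.  With \<open>r = max (\<Phi>1 u) (\<Phi>2 v)\<close>, monotonicity
  gives \<open>u \<le> \<Phi>1\<^sup>-\<^sup>1 r\<close> and \<open>v \<le> \<Phi>2\<^sup>-\<^sup>1 r\<close>, hence \<open>u v \<le> \<Phi>3\<^sup>-\<^sup>1 r\<close>, and \<open>\<Phi>3 \<le> r\<close> strictly below \<open>\<Phi>3\<^sup>-\<^sup>1 r\<close>.
  At \<open>s = u v\<close> itself the bound can fail: a Young function may jump to \<open>\<infinity>\<close> and need not be
  left-continuous at that jump.\<close>

lemma young_product_le:
  assumes y: "young_function \<Phi>1" "young_function \<Phi>2" "young_function \<Phi>3"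
    and inv: "\<And>x. 0 \<le> x \<Longrightarrow> young_inverse \<Phi>1 x * young_inverse \<Phi>2 x \<le> young_inverse \<Phi>3 x"
    and uv: "0 \<le> u" "0 \<le> v" and s: "s < u * v" "0 \<le> s"
  shows "\<Phi>3 s \<le> \<Phi>1 u + \<Phi>2 v"
proof (cases "max (\<Phi>1 u) (\<Phi>2 v) = \<infinity>")
  case True
  then show ?thesis by (auto simp: max_def split: if_splits)
next
  case False
  then obtain r where r: "max (\<Phi>1 u) (\<Phi>2 v) = ennreal r" "0 \<le> r"
    by (cases "max (\<Phi>1 u) (\<Phi>2 v)") auto
  have le: "ennreal w \<le> young_inverse \<Phi> r" if "young_function \<Phi>" "\<Phi> w \<le> ennreal r" "0 \<le> w" for \<Phi> w
    unfolding young_inverse_def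
  proof (rule INF_greatest)
    fix x assume x: "x \<in> {x. 0 < x \<and> ennreal r < \<Phi> x}"
    then have "\<not> x \<le> w" using young_mono[OF that(1), of x w] that(2) by auto
    then show "ennreal w \<le> ennreal x" by (simp add: ennreal_leI)
  qed
  have "ennreal (u * v) \<le> young_inverse \<Phi>1 r * young_inverse \<Phi>2 r"
    unfolding ennreal_mult[OF uv]
    by (intro mult_mono le y uv) (use r in \<open>auto simp flip: r(1)\<close>)
  also have "\<dots> \<le> young_inverse \<Phi>3 r" by (rule inv) fact
  finally have uv3: "ennreal (u * v) \<le> young_inverse \<Phi>3 r" .
  have "\<Phi>3 s \<le> ennreal r"
  proof (cases "s = 0")
    case True
    then show ?thesis using y(3) by (simp add: young_function_def)
  next
    case False
    show ?thesis
    proof (rule ccontr)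
      assume "\<not> \<Phi>3 s \<le> ennreal r"
      then have "young_inverse \<Phi>3 r \<le> ennreal s"
        unfolding young_inverse_def using False s by (intro INF_lower) auto
      with uv3 have "ennreal (u * v) \<le> ennreal s" by (rule order_trans)
      then show False using s by (simp add: ennreal_le_iff)
    qed
  qed
  also have "\<dots> \<le> \<Phi>1 u + \<Phi>2 v" unfolding r(1)[symmetric] by (simp add: max_def)
  finally show ?thesis .
qed

text \<open>Convexity and \<open>\<Phi>3 0 = 0\<close> turn the sum in the product bound into a mean, which is at most \<open>1\<close>
  after integration if both modulars are.\<close>

lemma young_half_product_le:
  assumes y: "young_function \<Phi>1" "young_function \<Phi>2" "young_function \<Phi>3"
    and inv: "\<And>x. 0 \<le> x \<Longrightarrow> young_inverse \<Phi>1 x * young_inverse \<Phi>2 x \<le> young_inverse \<Phi>3 x"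
    and uv: "0 \<le> u" "0 \<le> v" and \<rho>: "0 \<le> \<rho>" "\<rho> < 1"
  shows "\<Phi>3 (\<rho> * (u * v) / 2) \<le> ennreal (1/2) * (\<Phi>1 u + \<Phi>2 v)"
proof (cases "u * v = 0")
  case True
  then have "\<rho> * (u * v) / 2 = 0" by simp
  moreover have "\<Phi>3 0 = 0" using y(3) by (simp add: young_function_def)
  ultimately show ?thesis by (simp only: zero_le)
next
  case False
  then have "0 < u * v" using uv by (simp add: less_le)
  then have lt: "\<rho> * (u * v) < u * v" using mult_strict_right_mono[OF \<rho>(2)] by (simp only: mult_1_left)
  have "\<Phi>3 (\<rho> * (u * v) / 2) = \<Phi>3 ((1/2) * (\<rho> * (u * v)))" by simp
  also have "\<dots> \<le> ennreal (1/2) * \<Phi>3 (\<rho> * (u * v))" by (rule young_scale[OF y(3)]) auto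
  also have "\<dots> \<le> ennreal (1/2) * (\<Phi>1 u + \<Phi>2 v)"
    by (intro mult_left_mono young_product_le[OF y inv uv lt]) (use uv \<rho> in auto)
  finally show ?thesis .
qed

text \<open>A supporting line of slope \<open>p\<close> at \<open>s\<close>, written without subtraction so that it makes sense for
  extended values.  Finiteness at some \<open>m > s\<close> puts \<open>s\<close> in the interior of the domain where \<open>\<Phi>\<close> is
  finite, and there real convexity provides the slope.\<close>

lemma young_support_line:
  assumes "young_function \<Phi>" "0 < s" "s < m" "\<Phi> m < \<infinity>"
  obtains p where "0 \<le> p" "\<And>x. 0 \<le> x \<Longrightarrow> \<Phi> s + ennreal p * ennreal x \<le> \<Phi> x + ennreal p * ennreal s"
proof -
  define I where "I = {x. \<Phi> x < \<infinity>}"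
  have cv: "\<Phi> ((1 - t) * x + t * y) \<le> ennreal (1 - t) * \<Phi> x + ennreal t * \<Phi> y"
    if "0 \<le> t" "t \<le> 1" for x y t
    using assms(1) that unfolding young_function_def by blast
  have \<Phi>I: "\<Phi> x = ennreal (enn2real (\<Phi> x))" if "x \<in> I" for x
    using that by (simp add: I_def)
  have Iabs: "x \<in> I" if "\<bar>x\<bar> \<le> m" for x
  proof -
    have "\<Phi> \<bar>x\<bar> \<le> \<Phi> m" using that by (intro young_mono assms) auto
    then show ?thesis using assms(4) by (simp add: I_def young_abs[OF assms(1)])
  qed
  have fin: "ennreal (1 - t) * \<Phi> x + ennreal t * \<Phi> y
    = ennreal ((1 - t) * enn2real (\<Phi> x) + t * enn2real (\<Phi> y))"
    if "0 \<le> t" "t \<le> 1" "x \<in> I" "y \<in> I" for x y t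
    using that by (subst (1) \<Phi>I, simp, subst (2) \<Phi>I, simp) (simp add: ennreal_mult ennreal_plus)
  have "convex I" unfolding convex_alt
  proof (intro ballI allI impI)
    fix x y u :: real assume "x \<in> I" "y \<in> I" "0 \<le> u \<and> u \<le> 1"
    then show "(1 - u) *\<^sub>R x + u *\<^sub>R y \<in> I"
      using cv[of u x y] fin[of u x y] by (auto simp: I_def top_unique intro: le_less_trans)
  qed
  have cvx: "convex_on I (\<lambda>x. enn2real (\<Phi> x))"
  proof (rule convex_onI[OF _ \<open>convex I\<close>])
    fix t x y :: real assume t: "0 < t" "t < 1" and xy: "x \<in> I" "y \<in> I"
    have "enn2real (\<Phi> ((1 - t) * x + t * y))
      \<le> enn2real (ennreal ((1 - t) * enn2real (\<Phi> x) + t * enn2real (\<Phi> y)))"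
      using cv[of t x y] t xy by (intro enn2real_mono) (auto simp: fin)
    then show "enn2real (\<Phi> ((1 - t) *\<^sub>R x + t *\<^sub>R y)) \<le> (1 - t) * enn2real (\<Phi> x) + t * enn2real (\<Phi> y)"
      using t by (subst (asm) enn2real_ennreal) simp_all
  qed
  have "s \<in> {-m<..<m}" "{-m<..<m} \<subseteq> I" using assms Iabs by auto
  then have sint: "s \<in> interior I" by (meson interiorI open_greaterThanLessThan)
  define q where "q = Inf ((\<lambda>t. (enn2real (\<Phi> s) - enn2real (\<Phi> t)) / (s - t)) ` ({s<..} \<inter> I))"
  have q: "enn2real (\<Phi> y) \<ge> enn2real (\<Phi> s) + q * (y - s)" if "y \<in> I" for y
    unfolding q_def by (rule convex_le_Inf_differential[OF cvx sint that])
  have sI: "s \<in> I" "0 \<in> I" using assms by (auto intro!: Iabs)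
  have "0 \<le> q"
  proof (rule ccontr)
    assume "\<not> 0 \<le> q"
    then have "q * (0 - s) > 0" using assms(2) by (simp add: mult_neg_pos)
    with q[OF sI(2)] have "enn2real (\<Phi> s) < enn2real (\<Phi> 0)" by simp
    moreover have "\<Phi> 0 = 0" using assms(1) by (simp add: young_function_def)
    ultimately show False using enn2real_nonneg[of "\<Phi> s"] by simp
  qed
  show thesis
  proof (rule that[OF \<open>0 \<le> q\<close>])
    fix x :: real assume x: "0 \<le> x"
    show "\<Phi> s + ennreal q * ennreal x \<le> \<Phi> x + ennreal q * ennreal s"
    proof (cases "x \<in> I")
      case False then show ?thesis by (simp add: I_def less_top[symmetric])
    next
      case True
      have "\<Phi> s + ennreal q * ennreal x = ennreal (enn2real (\<Phi> s) + q * x)"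
        using \<open>0 \<le> q\<close> x by (subst \<Phi>I[OF sI(1)]) (simp add: ennreal_mult ennreal_plus)
      also have "\<dots> \<le> ennreal (enn2real (\<Phi> x) + q * s)"
        using q[OF True] by (intro ennreal_leI) (simp add: algebra_simps)
      also have "\<dots> = \<Phi> x + ennreal q * ennreal s"
        using \<open>0 \<le> q\<close> assms by (subst (2) \<Phi>I[OF True]) (simp add: ennreal_mult ennreal_plus)
      finally show ?thesis .
    qed
  qed
qed

text \<open>Jensen's inequality below the mean.  If \<open>\<Phi>\<close> is finite somewhere above \<open>s\<close>, integrate a supporting
  line at \<open>s\<close>.  Otherwise \<open>\<Phi>\<close> is infinite beyond \<open>s\<close>; since the mean exceeds \<open>s\<close>, the variable exceeds
  \<open>s\<close> with positive probability and the right-hand side is \<open>\<infinity>\<close>.\<close>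

lemma young_Jensen:
  assumes \<Phi>: "young_function \<Phi>" and "prob_space P"
    and X[measurable]: "X \<in> borel_measurable P" and X0: "\<And>x. 0 \<le> X x"
    and s: "0 \<le> s" "ennreal s < (\<integral>\<^sup>+x. ennreal (X x) \<partial>P)"
  shows "\<Phi> s \<le> (\<integral>\<^sup>+x. \<Phi> (X x) \<partial>P)"
proof -
  interpret prob_space P by fact
  note young_comp_borel[OF \<Phi>, measurable]
  consider "s = 0" | "0 < s" "\<exists>m>s. \<Phi> m < \<infinity>" | "0 < s" "\<forall>m>s. \<Phi> m = \<infinity>"
    using s by (auto simp: less_top[symmetric]) (metis infinity_ennreal_def less_eq_real_def)
  then show ?thesis
  proof cases
    case 1 then show ?thesis using \<Phi> by (simp add: young_function_def)
  next
    case 2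
    then obtain m where m: "s < m" "\<Phi> m < \<infinity>" by blast
    obtain p where p: "0 \<le> p" "\<And>x. 0 \<le> x \<Longrightarrow> \<Phi> s + ennreal p * ennreal x \<le> \<Phi> x + ennreal p * ennreal s"
      using young_support_line[OF \<Phi> 2(1) m] by blast
    have "(\<Phi> s + ennreal p * ennreal s) \<le> \<Phi> s + ennreal p * (\<integral>\<^sup>+x. ennreal (X x) \<partial>P)"
      using s by (intro add_left_mono mult_left_mono) auto
    also have "\<dots> = (\<integral>\<^sup>+x. \<Phi> s + ennreal p * ennreal (X x) \<partial>P)"
      by (simp add: nn_integral_add nn_integral_cmult emeasure_space_1)
    also have "\<dots> \<le> (\<integral>\<^sup>+x. \<Phi> (X x) + ennreal p * ennreal s \<partial>P)"
      by (intro nn_integral_mono p X0)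
    also have "\<dots> = (\<integral>\<^sup>+x. \<Phi> (X x) \<partial>P) + ennreal p * ennreal s"
      by (simp add: nn_integral_add emeasure_space_1)
    finally show ?thesis by (simp add: ennreal_mult'[symmetric] ennreal_mult[symmetric] p(1) add.commute[of _ "ennreal _"])
  next
    case 3
    have "\<not> (AE x in P. X x \<le> s)"
    proof
      assume "AE x in P. X x \<le> s"
      then have "(\<integral>\<^sup>+x. ennreal (X x) \<partial>P) \<le> (\<integral>\<^sup>+x. ennreal s \<partial>P)"
        by (intro nn_integral_mono_AE) (auto intro: ennreal_leI)
      then show False using s by (simp add: emeasure_space_1)
    qed
    then have "emeasure P {x \<in> space P. \<not> X x \<le> s} \<noteq> 0"
      by (subst (asm) AE_iff_measurable[OF _ refl]) auto
    moreover have "(\<integral>\<^sup>+x. \<infinity> * indicator {x \<in> space P. \<not> X x \<le> s} x \<partial>P) \<le> (\<integral>\<^sup>+x. \<Phi> (X x) \<partial>P)"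
      using 3 by (intro nn_integral_mono) (auto split: split_indicator)
    ultimately show ?thesis
      by (subst (asm) nn_integral_cmult_indicator) (auto simp: ennreal_top_mult top_unique)
  qed
qed

lemma luxemburg_norm_upper:
  assumes "0 < c" "(\<integral>\<^sup>+ x. \<Phi> (norm (f x) / c) \<partial>lebesgue) \<le> 1"
  shows "luxemburg_norm \<Phi> f \<le> ennreal c"
  unfolding luxemburg_norm_def using assms by (intro INF_lower) auto

text \<open>The admissible scaling factors form an up-set, because \<open>\<Phi>\<close> is increasing on \<open>[0, \<infinity>)\<close>.\<close>

lemma luxemburg_norm_less_imp:
  assumes \<Phi>: "young_function \<Phi>" and "luxemburg_norm \<Phi> f < ennreal c"
  shows "0 < c" "(\<integral>\<^sup>+ x. \<Phi> (norm (f x) / c) \<partial>lebesgue) \<le> 1"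
proof -
  obtain a where a: "0 < a" "(\<integral>\<^sup>+ x. \<Phi> (norm (f x) / a) \<partial>lebesgue) \<le> 1" "ennreal a < ennreal c"
    using assms(2) unfolding luxemburg_norm_def by (auto simp: INF_less_iff)
  then have "a < c" by (simp add: ennreal_less_iff)
  then show "0 < c" using a by simp
  have "(\<integral>\<^sup>+ x. \<Phi> (norm (f x) / c) \<partial>lebesgue) \<le> (\<integral>\<^sup>+ x. \<Phi> (norm (f x) / a) \<partial>lebesgue)"
    using a(1) \<open>a < c\<close> by (intro nn_integral_mono young_mono[OF \<Phi>]) (auto intro!: divide_left_mono)
  with a(2) show "(\<integral>\<^sup>+ x. \<Phi> (norm (f x) / c) \<partial>lebesgue) \<le> 1" by simp
qed

lemma luxemburg_norm_AE_cong:
  assumes "AE x in lebesgue. f x = g x"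
  shows "luxemburg_norm \<Phi> f = luxemburg_norm \<Phi> g"
proof -
  have "(\<integral>\<^sup>+ x. \<Phi> (norm (f x) / c) \<partial>lebesgue) = (\<integral>\<^sup>+ x. \<Phi> (norm (g x) / c) \<partial>lebesgue)" for c
    using assms by (intro nn_integral_cong_AE) auto
  then show ?thesis unfolding luxemburg_norm_def by simp
qed

lemma luxemburg_norm_zero:
  assumes "young_function \<Phi>"
  shows "luxemburg_norm \<Phi> (\<lambda>x. 0) = 0"
proof -
  have "luxemburg_norm \<Phi> (\<lambda>x. 0) \<le> ennreal c" if "0 < c" for c
    using assms that by (intro luxemburg_norm_upper) (auto simp: young_function_def)
  then have "luxemburg_norm \<Phi> (\<lambda>x. 0) \<le> 0 + ennreal c" if "0 < c" for c using that by simp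
  then have "luxemburg_norm \<Phi> (\<lambda>x. 0) \<le> 0" by (rule ennreal_le_epsilon)
  then show ?thesis by simp
qed

text \<open>If every scaling factor is admissible, then \<open>\<Phi> (d t) \<le> d \<Phi> t\<close> for \<open>d \<le> 1\<close> shows that the modular of every
  multiple of \<open>f\<close> is at most any \<open>d > 0\<close>, hence zero.  So \<open>\<Phi>\<close> vanishes at all multiples of \<open>\<bar>f x\<bar>\<close> for
  almost every \<open>x\<close>, which forces \<open>f x = 0\<close> because \<open>\<Phi>\<close> is nonzero somewhere.\<close>

lemma luxemburg_norm_eq_0_imp:
  assumes \<Phi>: "young_function \<Phi>" and f[measurable]: "f \<in> borel_measurable lebesgue"
    and 0: "luxemburg_norm \<Phi> f = 0"
  shows "AE x in lebesgue. f x = 0"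
proof -
  note young_comp_borel[OF \<Phi>, measurable]
  obtain x0 where x0: "0 \<le> x0" "\<Phi> x0 \<noteq> 0"
    using \<Phi> unfolding young_function_def by (metis abs_ge_zero young_abs[OF \<Phi>])
  have "AE x in lebesgue. \<Phi> (real k * norm (f x)) = 0" for k
  proof (cases "k = 0")
    case True then show ?thesis using \<Phi> by (simp add: young_function_def)
  next
    case False
    have "(\<integral>\<^sup>+x. \<Phi> (real k * norm (f x)) \<partial>lebesgue) \<le> 0 + ennreal e" if "0 < e" for e
    proof -
      define d where "d = min 1 e"
      have d: "0 < d" "d \<le> 1" "d \<le> e" using that by (auto simp: d_def)
      have "\<Phi> (real k * norm (f x)) \<le> ennreal d * \<Phi> (norm (f x) / (d / real k))" for x
        using young_scale[OF \<Phi>, of d "norm (f x) / (d / real k)"] d False by (simp add: field_simps)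
      then have "(\<integral>\<^sup>+x. \<Phi> (real k * norm (f x)) \<partial>lebesgue)
        \<le> (\<integral>\<^sup>+x. ennreal d * \<Phi> (norm (f x) / (d / real k)) \<partial>lebesgue)"
        by (rule nn_integral_mono)
      also have "\<dots> = ennreal d * (\<integral>\<^sup>+x. \<Phi> (norm (f x) / (d / real k)) \<partial>lebesgue)"
        by (intro nn_integral_cmult) measurable
      also have "\<dots> \<le> ennreal d * 1"
        using d False 0 by (intro mult_left_mono luxemburg_norm_less_imp(2)[OF \<Phi>]) auto
      also have "\<dots> \<le> ennreal e" using d by (simp add: ennreal_leI)
      finally show ?thesis by simp
    qed
    then have "(\<integral>\<^sup>+x. \<Phi> (real k * norm (f x)) \<partial>lebesgue) \<le> 0" by (rule ennreal_le_epsilon)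
    then show ?thesis by (subst (asm) le_zero_eq, subst (asm) nn_integral_0_iff_AE) auto
  qed
  then have "AE x in lebesgue. \<forall>k. \<Phi> (real k * norm (f x)) = 0" by (simp add: AE_all_countable)
  then show ?thesis
  proof eventually_elim
    case (elim x)
    show "f x = 0"
    proof (rule ccontr)
      assume "f x \<noteq> 0"
      then obtain k where "x0 < real k * norm (f x)" using reals_Archimedean3[of "norm (f x)"] by auto
      then have "\<Phi> x0 \<le> \<Phi> (real k * norm (f x))" using x0 by (intro young_mono[OF \<Phi>]) auto
      with elim x0 show False by simp
    qed
  qed
qed

section \<open>Fourier inversion for integrable functions with integrable transform\<close>

text \<open>Fubini's theorem in the shape in which every interchange below occurs: the kernel is bounded, so
  \<open>f x * g y\<close> dominates the integrand up to a constant.\<close>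

lemma integral_swap_bounded_kernel:
  fixes f :: "'a \<Rightarrow> complex" and g :: "'b \<Rightarrow> complex" and k :: "'a \<Rightarrow> 'b \<Rightarrow> complex"
  assumes sf: "sigma_finite_measure M" "sigma_finite_measure N"
    and f: "integrable M f" and g: "integrable N g"
    and k[measurable]: "case_prod k \<in> borel_measurable (M \<Otimes>\<^sub>M N)" and B: "\<And>x y. norm (k x y) \<le> B"
  shows "(LINT x|M. f x * (LINT y|N. g y * k x y)) = (LINT y|N. g y * (LINT x|M. f x * k x y))"
proof -
  interpret M: sigma_finite_measure M by fact
  interpret N: sigma_finite_measure N by fact
  interpret pair_sigma_finite M N ..
  have [measurable]: "f \<in> borel_measurable M" "g \<in> borel_measurable N" using f g by auto
  have B0: "0 \<le> B" using B[of undefined undefined] norm_ge_zero order_trans by blast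
  have inner: "integrable N (\<lambda>y. f x * (g y * k x y))" if "x \<in> space M" for x
  proof (rule Bochner_Integration.integrable_bound[where f="\<lambda>y. norm (f x) * B * norm (g y)"])
    show "AE y in N. norm (f x * (g y * k x y)) \<le> norm (norm (f x) * B * norm (g y))"
    proof (rule AE_I2)
      fix y
      show "norm (f x * (g y * k x y)) \<le> norm (norm (f x) * B * norm (g y))"
        using mult_left_mono[OF B, of "norm (f x) * norm (g y)" x y] B0
        by (simp add: norm_mult mult_ac abs_mult)
    qed
  qed (use g that in auto)
  have "integrable (M \<Otimes>\<^sub>M N) (\<lambda>(x, y). f x * (g y * k x y))"
  proof (rule Fubini_integrable)
    show "integrable M (\<lambda>x. \<integral> y. norm (case (x, y) of (x, y) \<Rightarrow> f x * (g y * k x y)) \<partial>N)"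
    proof (rule Bochner_Integration.integrable_bound[where f="\<lambda>x. norm (f x) * (B * (LINT y|N. norm (g y)))"])
      show "integrable M (\<lambda>x. norm (f x) * (B * (LINT y|N. norm (g y))))" using f by auto
      show "AE x in M. norm (\<integral> y. norm (case (x, y) of (x, y) \<Rightarrow> f x * (g y * k x y)) \<partial>N)
             \<le> norm (norm (f x) * (B * (LINT y|N. norm (g y))))"
      proof (rule AE_I2)
        fix x assume x: "x \<in> space M"
        have "(\<integral> y. norm (f x * (g y * k x y)) \<partial>N) \<le> (\<integral> y. norm (f x) * B * norm (g y) \<partial>N)"
        proof (intro integral_mono)
          fix y
          show "norm (f x * (g y * k x y)) \<le> norm (f x) * B * norm (g y)"
            using mult_left_mono[OF B, of "norm (f x) * norm (g y)" x y]
            by (simp add: norm_mult mult_ac)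
        qed (use inner[OF x] g in auto)
        then show "norm (\<integral> y. norm (case (x, y) of (x, y) \<Rightarrow> f x * (g y * k x y)) \<partial>N)
             \<le> norm (norm (f x) * (B * (LINT y|N. norm (g y))))"
          using B0 by (simp add: mult.assoc)
      qed
    qed measurable
  qed (auto intro: inner)
  then have "(LINT y|N. LINT x|M. f x * (g y * k x y)) = (LINT x|M. LINT y|N. f x * (g y * k x y))"
    by (rule Fubini_integral)
  moreover have "(LINT x|M. f x * (g y * k x y)) = g y * (LINT x|M. f x * k x y)" for y
    by (simp add: mult.left_commute[of _ "g y"])
  ultimately show ?thesis by simp
qed

text \<open>The Gaussian is its own Fourier transform, rescaled from the characteristic function of the
  standard normal distribution by \<open>z = 2 \<pi> \<sigma> \<xi>\<close>.\<close>

lemma integral_Gaussian_cis: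
  assumes "0 < \<sigma>"
  shows "(LINT \<xi>|lborel. complex_of_real (exp (- (2 * pi * \<sigma> * \<xi>)\<^sup>2 / 2)) * cis (2 * pi * \<xi> * u))
     = complex_of_real (normal_density 0 \<sigma> u)"
proof -
  have "(LINT z|lborel. complex_of_real (exp (- z\<^sup>2 / 2)) * cis (z * u / \<sigma>))
      = sqrt (2 * pi) * complex_of_real (exp (- (u / \<sigma>)\<^sup>2 / 2))"
  proof -
    have "char std_normal_distribution (u / \<sigma>)
        = (LINT z|lborel. std_normal_density z *\<^sub>R iexp (u / \<sigma> * z))"
      unfolding char_def by (subst integral_density) (auto simp: normal_density_nonneg)
    also have "\<dots> = (LINT z|lborel. complex_of_real (1 / sqrt (2 * pi)) * (complex_of_real (exp (- z\<^sup>2 / 2)) * cis (z * u / \<sigma>)))"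
      by (intro Bochner_Integration.integral_cong)
        (auto simp: std_normal_density_def cis_conv_exp scaleR_conv_of_real mult_ac)
    also have "\<dots> = complex_of_real (1 / sqrt (2 * pi)) * (LINT z|lborel. complex_of_real (exp (- z\<^sup>2 / 2)) * cis (z * u / \<sigma>))"
      by simp
    finally show ?thesis
      unfolding char_std_normal_distribution by (simp add: field_simps)
  qed
  moreover have "(LINT z|lborel. complex_of_real (exp (- z\<^sup>2 / 2)) * cis (z * u / \<sigma>))
     = (2 * pi * \<sigma>) *\<^sub>R (LINT \<xi>|lborel. complex_of_real (exp (- (2 * pi * \<sigma> * \<xi>)\<^sup>2 / 2)) * cis (2 * pi * \<xi> * u))"
    using assms
    by (subst lborel_integral_real_affine[where c="2 * pi * \<sigma>"
      and t=0]) (auto intro!: arg_cong2[where f="(*\<^sub>R)"] Bochner_Integration.integral_cong simp: field_simps)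
  ultimately have "(LINT \<xi>|lborel. complex_of_real (exp (- (2 * pi * \<sigma> * \<xi>)\<^sup>2 / 2)) * cis (2 * pi * \<xi> * u))
     = complex_of_real (sqrt (2 * pi) * exp (- (u / \<sigma>)\<^sup>2 / 2) / (2 * pi * \<sigma>))"
    using assms by (simp add: scaleR_conv_of_real field_simps)
  also have "sqrt (2 * pi) * exp (- (u / \<sigma>)\<^sup>2 / 2) / (2 * pi * \<sigma>) = normal_density 0 \<sigma> u"
  proof -
    have "2 * pi * \<sigma> = sqrt (2 * pi) * sqrt (2 * pi * \<sigma>\<^sup>2)"
      using assms by (simp add: real_sqrt_mult[of "2 * pi" "\<sigma>\<^sup>2"] flip: mult.assoc)
    then show ?thesis using assms by (simp add: normal_density_def field_simps)
  qed
  finally show ?thesis .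
qed

text \<open>Substituting \<open>x = y + \<sigma> z\<close> turns the integral into the mean of \<open>indicator {a..b} (y + \<sigma> z)\<close> under a
  standard normal \<open>z\<close>; the indicator is continuous at \<open>y\<close> because \<open>y\<close> is not an endpoint.\<close>

lemma integral_normal_density_interval_tendsto:
  assumes "\<And>n. 0 < \<sigma> n" "\<sigma> \<longlonglongrightarrow> 0" "y \<noteq> a" "y \<noteq> b"
  shows "(\<lambda>n. LINT x|lborel. indicator {a..b} x * normal_density 0 (\<sigma> n) (x - y))
    \<longlonglongrightarrow> (indicator {a..b} y :: real)"
proof -
  have eq: "(LINT x|lborel. indicator {a..b} x * normal_density 0 s (x - y))
     = (LINT z|lborel. indicator {a..b} (y + s * z) * std_normal_density z)" if "0 < s" for s
  proof -
    have "s * normal_density 0 s (s * z) = std_normal_density z" for z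
      using that by (simp add: normal_density_def real_sqrt_mult field_simps)
    then have *: "s * (indicator {a..b} (y + s * z) * normal_density 0 s (s * z))
        = indicator {a..b} (y + s * z) * std_normal_density z" for z
      by (metis mult.left_commute)
    show ?thesis using that
      by (subst lborel_integral_real_affine[where c=s and t=y])
         (auto simp: *[symmetric] simp flip: integral_mult_right_zero)
  qed
  have "(\<lambda>n. LINT z|lborel. indicator {a..b} (y + \<sigma> n * z) * std_normal_density z)
     \<longlonglongrightarrow> (LINT z|lborel. indicator {a..b} y * std_normal_density z)"
  proof (rule integral_dominated_convergence[where w=std_normal_density])
    show "AE z in lborel. (\<lambda>n. indicator {a..b} (y + \<sigma> n * z) * std_normal_density z)
       \<longlonglongrightarrow> indicator {a..b} y * std_normal_density z"
    proof (intro AE_I2 tendsto_mult tendsto_const)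
      fix z
      have "y \<notin> frontier {a..b}" using assms by (auto simp: frontier_def)
      moreover have "(\<lambda>n. y + \<sigma> n * z) \<longlonglongrightarrow> y"
        using tendsto_add[OF tendsto_const tendsto_mult_left_zero[OF assms(2)]] by simp
      ultimately show "(\<lambda>n. indicator {a..b} (y + \<sigma> n * z)) \<longlonglongrightarrow> (indicator {a..b} y::real)"
        using isCont_indicator[of y "{a..b}"] isCont_tendsto_compose by blast
    qed
  qed (auto simp: split: split_indicator)
  then show ?thesis by (simp add: eq assms(1))
qed

definition inverse_fourier :: "(real \<Rightarrow> complex) \<Rightarrow> real \<Rightarrow> complex" where
  "inverse_fourier F x = (LINT \<xi>|lborel. F \<xi> * cis (2 * pi * \<xi> * x))"

lemma cis_borel [measurable (raw)]:
  "f \<in> borel_measurable N \<Longrightarrow> (\<lambda>x. cis (f x)) \<in> borel_measurable N"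
  by (rule borel_measurable_continuous_on[where f=cis]) (auto intro: continuous_intros)

lemma inverse_fourier_borel [measurable]:
  assumes [measurable]: "F \<in> borel_measurable borel"
  shows "inverse_fourier F \<in> borel_measurable borel"
  unfolding inverse_fourier_def by measurable

lemma norm_inverse_fourier_le:
  "norm (inverse_fourier F x) \<le> (LINT \<xi>|lborel. norm (F \<xi>))"
proof -
  have "norm (inverse_fourier F x) \<le> (LINT \<xi>|lborel. norm (F \<xi> * cis (2 * pi * \<xi> * x)))"
    unfolding inverse_fourier_def by (rule integral_norm_bound)
  then show ?thesis by (simp add: norm_mult)
qed

text \<open>Damp \<open>F\<close> by the Gaussian \<open>\<gamma> n\<close>.  As the damping disappears, the inverse transforms \<open>f\<^sub>n n\<close> tend to
  \<open>inverse_fourier F\<close> boundedly.  On the other hand \<open>f\<^sub>n n\<close> is the convolution of \<open>f\<close> with a narrow normal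
  density, so its integral over \<open>[a, b]\<close> is the integral of \<open>f\<close> against \<open>k n\<close>, a smoothed indicator of
  \<open>[a, b]\<close>.\<close>

lemma interval_integral_inverse_fourier:
  fixes f :: "real \<Rightarrow> complex"
  assumes f: "integrable lborel f"
    and F: "F = (\<lambda>\<xi>. LINT x|lborel. f x * cis (- 2 * pi * x * \<xi>))" and Fi: "integrable lborel F"
  shows "(LINT x|lborel. indicator {a..b} x * inverse_fourier F x)
    = (LINT x|lborel. indicator {a..b} x * f x)"
proof -
  have [measurable]: "f \<in> borel_measurable borel" "F \<in> borel_measurable borel" using f Fi by auto
  define I :: "real \<Rightarrow> complex" where "I = indicator {a..b}"
  have I: "integrable lborel I" unfolding I_def
    by (rule Bochner_Integration.integrable_bound[where f="indicator {a..b} :: real \<Rightarrow> real"])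
       (auto intro!: integrable_real_indicator simp: emeasure_lborel_Icc_eq split: split_indicator)
  define \<sigma> :: "nat \<Rightarrow> real" where "\<sigma> n = inverse (real (Suc n))" for n
  have \<sigma>: "0 < \<sigma> n" "\<sigma> \<longlonglongrightarrow> 0" for n
    using LIMSEQ_inverse_real_of_nat by (simp_all add: \<sigma>_def[abs_def])
  define \<gamma> where "\<gamma> n \<xi> = exp (- (2 * pi * \<sigma> n * \<xi>)\<^sup>2 / 2)" for n \<xi>
  have \<gamma>m[measurable]: "\<gamma> n \<in> borel_measurable borel" for n unfolding \<gamma>_def by measurable
  have \<gamma>1: "\<bar>\<gamma> n \<xi>\<bar> \<le> 1" for n \<xi> by (simp add: \<gamma>_def)
  have \<gamma>l: "(\<lambda>n. \<gamma> n \<xi>) \<longlonglongrightarrow> 1" for \<xi>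
    unfolding \<gamma>_def using \<sigma>(2) by (auto intro!: tendsto_eq_intros)
  have \<gamma>i: "integrable lborel (\<lambda>\<xi>. complex_of_real (\<gamma> n \<xi>))" for n
  proof -
    have "integrable lborel (\<lambda>\<xi>. normal_density 0 1 (0 + (2 * pi * \<sigma> n) * \<xi>))"
      using \<sigma>(1)[of n] by (intro lborel_integrable_real_affine) auto
    then have "integrable lborel (\<lambda>\<xi>. complex_of_real (sqrt (2 * pi) * normal_density 0 1 (0 + (2 * pi * \<sigma> n) * \<xi>)))"
      by (intro integrable_of_real integrable_mult_right)
    then show ?thesis by (simp add: \<gamma>_def normal_density_def)
  qed
  define f\<^sub>n where "f\<^sub>n n x = (LINT \<xi>|lborel. F \<xi> * (complex_of_real (\<gamma> n \<xi>) * cis (2 * pi * \<xi> * x)))" for n x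
  have nf: "norm (f\<^sub>n n x) \<le> (LINT \<xi>|lborel. norm (F \<xi>))" for n x
  proof -
    have "norm (f\<^sub>n n x) \<le> (LINT \<xi>|lborel. norm (F \<xi> * (complex_of_real (\<gamma> n \<xi>) * cis (2 * pi * \<xi> * x))))"
      unfolding f\<^sub>n_def by (rule integral_norm_bound)
    also have "\<dots> \<le> (LINT \<xi>|lborel. norm (F \<xi>))"
      using Fi \<gamma>1 by (intro integral_mono_AE') (auto simp: norm_mult mult_left_le)
    finally show ?thesis .
  qed
  \<comment> \<open>the damping is removed by dominated convergence\<close>
  have lim1: "(\<lambda>n. LINT x|lborel. I x * f\<^sub>n n x) \<longlonglongrightarrow> (LINT x|lborel. I x * inverse_fourier F x)"
  proof (rule integral_dominated_convergence[where w="\<lambda>x. norm (I x) * (LINT \<xi>|lborel. norm (F \<xi>))"])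
    show "AE x in lborel. (\<lambda>n. I x * f\<^sub>n n x) \<longlonglongrightarrow> I x * inverse_fourier F x"
    proof (intro AE_I2 tendsto_mult tendsto_const)
      fix x show "(\<lambda>n. f\<^sub>n n x) \<longlonglongrightarrow> inverse_fourier F x"
        unfolding f\<^sub>n_def inverse_fourier_def
      proof (rule integral_dominated_convergence[where w="\<lambda>\<xi>. norm (F \<xi>)"])
        show "AE \<xi> in lborel. (\<lambda>n. F \<xi> * (complex_of_real (\<gamma> n \<xi>) * cis (2 * pi * \<xi> * x)))
          \<longlonglongrightarrow> F \<xi> * cis (2 * pi * \<xi> * x)"
          using tendsto_mult[OF tendsto_const tendsto_mult[OF tendsto_of_real[OF \<gamma>l] tendsto_const]]
          by (intro AE_I2) simp
        show "AE \<xi> in lborel. norm (F \<xi> * (complex_of_real (\<gamma> n \<xi>) * cis (2 * pi * \<xi> * x)))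
          \<le> norm (F \<xi>)" for n
          using \<gamma>1 by (auto simp: norm_mult mult_left_le)
      qed (use Fi in auto)
    qed
    show "AE x in lborel. norm (I x * f\<^sub>n n x) \<le> norm (I x) * (LINT \<xi>|lborel. norm (F \<xi>))" for n
      using nf by (auto simp: norm_mult intro!: mult_left_mono)
  qed (use I in \<open>auto simp: f\<^sub>n_def\<close>)
  \<comment> \<open>the convolution form of the damped inverse transform\<close>
  have fn: "f\<^sub>n n x = (LINT y|lborel. f y * complex_of_real (normal_density 0 (\<sigma> n) (x - y)))" for n x
  proof -
    have "f\<^sub>n n x = (LINT \<xi>|lborel. complex_of_real (\<gamma> n \<xi>) * (LINT y|lborel. f y * (cis (- 2 * pi * y * \<xi>) * cis (2 * pi * \<xi> * x))))"
      unfolding f\<^sub>n_def F by (intro Bochner_Integration.integral_cong refl)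
        (simp add: mult_ac flip: integral_mult_left_zero integral_mult_right_zero)
    also have "\<dots> = (LINT y|lborel. f y * (LINT \<xi>|lborel. complex_of_real (\<gamma> n \<xi>) * (cis (- 2 * pi * y * \<xi>) * cis (2 * pi * \<xi> * x))))"
      by (rule integral_swap_bounded_kernel[where B=1])
        (auto simp: norm_mult f \<gamma>i lborel.sigma_finite_measure_axioms)
    also have "\<dots> = (LINT y|lborel. f y * (LINT \<xi>|lborel. complex_of_real (\<gamma> n \<xi>) * cis (2 * pi * \<xi> * (x - y))))"
      by (intro Bochner_Integration.integral_cong refl) (simp add: cis_mult algebra_simps)
    finally show ?thesis unfolding \<gamma>_def integral_Gaussian_cis[OF \<sigma>(1)] .
  qed
  define k where "k n y = (LINT x|lborel. indicator {a..b} x * normal_density 0 (\<sigma> n) (x - y))" for n y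
  have k: "0 \<le> k n y" "k n y \<le> 1" for n y
  proof -
    have i: "integrable lborel (\<lambda>x. normal_density 0 (\<sigma> n) (-y + 1 * x))"
      using \<sigma>(1) by (intro lborel_integrable_real_affine) auto
    have "k n y \<le> (LINT x|lborel. normal_density 0 (\<sigma> n) (-y + 1 * x))"
      unfolding k_def using i by (intro integral_mono_AE')
        (auto split: split_indicator simp: normal_density_nonneg)
    also have "\<dots> = (LINT x|lborel. normal_density 0 (\<sigma> n) x)"
      using lborel_integral_real_affine[of 1 "normal_density 0 (\<sigma> n)" "-y"] by simp
    also have "\<dots> = 1" using \<sigma>(1) by (simp add: integral_normal_density)
    finally show "k n y \<le> 1" .
    show "0 \<le> k n y" unfolding k_def by (intro integral_nonneg_AE) (auto simp: normal_density_nonneg)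
  qed
  have km[measurable]: "k n \<in> borel_measurable borel" for n unfolding k_def by measurable
  have "(LINT x|lborel. I x * f\<^sub>n n x) = (LINT y|lborel. f y * complex_of_real (k n y))" for n
  proof -
    have kc: "(LINT x|lborel. I x * complex_of_real (normal_density 0 (\<sigma> n) (x - y)))
      = complex_of_real (k n y)" for y
    proof -
      have "(LINT x|lborel. I x * complex_of_real (normal_density 0 (\<sigma> n) (x - y)))
        = (LINT x|lborel. complex_of_real (indicator {a..b} x * normal_density 0 (\<sigma> n) (x - y)))"
        unfolding I_def by (intro Bochner_Integration.integral_cong refl) (auto split: split_indicator)
      then show ?thesis unfolding k_def by (simp only: integral_complex_of_real)
    qed
    have "(LINT x|lborel. I x * f\<^sub>n n x)
      = (LINT y|lborel. f y * (LINT x|lborel. I x * complex_of_real (normal_density 0 (\<sigma> n) (x - y))))"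
      unfolding fn
    proof (rule integral_swap_bounded_kernel[where B="1 / sqrt (2 * pi * (\<sigma> n)\<^sup>2)"])
      fix x y show "norm (complex_of_real (normal_density 0 (\<sigma> n) (x - y)))
        \<le> 1 / sqrt (2 * pi * (\<sigma> n)\<^sup>2)"
      proof -
        have "normal_density 0 (\<sigma> n) (x - y) \<le> 1 / sqrt (2 * pi * (\<sigma> n)\<^sup>2)"
          using mult_left_mono[of "exp (- (x - y)\<^sup>2 / (2 * (\<sigma> n)\<^sup>2))" 1 "1 / sqrt (2 * pi * (\<sigma> n)\<^sup>2)"]
          by (simp add: normal_density_def)
        then show ?thesis using normal_density_nonneg[of 0 "\<sigma> n" "x - y"] by (subst norm_of_real) simp
      qed
    qed (auto simp: f I lborel.sigma_finite_measure_axioms)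
    also have "\<dots> = (LINT y|lborel. f y * complex_of_real (k n y))"
      by (simp only: kc)
    finally show ?thesis .
  qed
  moreover have "(\<lambda>n. LINT y|lborel. f y * complex_of_real (k n y)) \<longlonglongrightarrow> (LINT y|lborel. f y * I y)"
  proof (rule integral_dominated_convergence[where w="\<lambda>y. norm (f y)"])
    have "AE y in lborel. y \<noteq> a \<and> y \<noteq> b"
      using AE_lborel_singleton[of a] AE_lborel_singleton[of b] by eventually_elim auto
    then show "AE y in lborel. (\<lambda>n. f y * complex_of_real (k n y)) \<longlonglongrightarrow> f y * I y"
    proof eventually_elim
      case (elim y)
      have "(\<lambda>n. k n y) \<longlonglongrightarrow> indicator {a..b} y"
        unfolding k_def using elim by (intro integral_normal_density_interval_tendsto \<sigma>) auto
      then have "(\<lambda>n. f y * complex_of_real (k n y)) \<longlonglongrightarrow> f y * complex_of_real (indicator {a..b} y)"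
        by (intro tendsto_intros)
      moreover have "complex_of_real (indicator {a..b} y) = I y"
        by (auto simp: I_def split: split_indicator)
      ultimately show ?case by simp
    qed
    show "AE y in lborel. norm (f y * complex_of_real (k n y)) \<le> norm (f y)" for n
      using k by (auto simp: norm_mult mult_left_le)
  qed (use f in \<open>auto simp: I_def\<close>)
  ultimately show ?thesis
    using lim1 LIMSEQ_unique by (auto simp: I_def mult.commute)
qed

text \<open>The sets over which \<open>u\<close> integrates to zero contain the half-lines \<open>{..a}\<close> (this uses the bounded
  support), and a Dynkin argument extends this to all Borel sets.\<close>

lemma AE_eq_0_if_interval_integrals_0:
  fixes u :: "real \<Rightarrow> complex"
  assumes u: "integrable lborel u"
    and 0: "\<And>a b. (LINT x|lborel. indicator {a..b} x * u x) = 0"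
    and supp: "\<And>x. x \<notin> {-r..r} \<Longrightarrow> u x = 0"
  shows "AE x in lborel. u x = 0"
proof (rule sigma_finite_measure.density_zero[OF lborel.sigma_finite_measure_axioms u])
  have half: "(LINT x|lborel. indicator {..a} x *\<^sub>R u x) = 0" for a
  proof -
    have "(LINT x|lborel. indicator {..a} x *\<^sub>R u x) = (LINT x|lborel. indicator {-r..a} x * u x)"
      using supp by (intro Bochner_Integration.integral_cong) (auto split: split_indicator)
    then show ?thesis using 0 by simp
  qed
  have all: "(LINT x|lborel. u x) = 0"
  proof -
    have "(LINT x|lborel. u x) = (LINT x|lborel. indicator {-r..r} x * u x)"
      using supp by (intro Bochner_Integration.integral_cong) (auto split: split_indicator)
    then show ?thesis using 0 by simp
  qed
  have G: "Int_stable (range (\<lambda>a::real. {..a}))" "range (\<lambda>a::real. {..a}) \<subseteq> Pow UNIV"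
    by (auto simp: Int_stable_def)
  fix A assume "A \<in> sets (lborel :: real measure)"
  then have "A \<in> sigma_sets UNIV (range (\<lambda>a::real. {..a}))"
    by (simp add: borel_eq_atMost)
  from G this show "set_lebesgue_integral lborel A u = 0"
    unfolding set_lebesgue_integral_def
  proof (induction A rule: sigma_sets_induct_disjoint)
    case (basic A) then show ?case using half by auto
  next
    case empty then show ?case by simp
  next
    case (compl A)
    then have [measurable]: "A \<in> sets borel" by (simp add: borel_eq_atMost)
    have "(LINT x|lborel. indicator (UNIV - A) x *\<^sub>R u x) = (LINT x|lborel. u x - indicator A x *\<^sub>R u x)"
      by (intro Bochner_Integration.integral_cong) (auto split: split_indicator)
    also have "\<dots> = 0" using compl u all integrable_mult_indicator[of A lborel u]
      by (subst Bochner_Integration.integral_diff) auto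
    finally show ?case .
  next
    case (union A)
    then have A[measurable]: "A i \<in> sets borel" for i by (auto simp: borel_eq_atMost)
    have "set_lebesgue_integral lborel (\<Union>i. A i) u = (\<Sum>i. set_lebesgue_integral lborel (A i) u)"
      using union(1) u by (intro lebesgue_integral_countable_add)
        (auto simp: disjoint_family_on_def set_integrable_def intro!: integrable_mult_indicator)
    then show ?case using union by (simp add: set_lebesgue_integral_def)
  qed
qed

text \<open>\<open>inverse_fourier F\<close> need not be integrable on the line, so the two functions are compared on the
  bounded intervals \<open>[-r, r]\<close>.\<close>

lemma fourier_inversion:
  fixes f :: "real \<Rightarrow> complex"
  assumes f: "integrable lborel f"
    and F: "F = (\<lambda>\<xi>. LINT x|lborel. f x * cis (- 2 * pi * x * \<xi>))" and Fi: "integrable lborel F"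
  shows "AE x in lborel. f x = inverse_fourier F x"
proof -
  have [measurable]: "f \<in> borel_measurable borel" "F \<in> borel_measurable borel" using f Fi by auto
  have "AE x in lborel. indicator {-r..r} x * (f x - inverse_fourier F x) = 0" for r :: real
  proof (rule AE_eq_0_if_interval_integrals_0[where r=r])
    have int: "integrable lborel (\<lambda>x. indicator {a..b} x * f x)" "integrable lborel (\<lambda>x. indicator {a..b} x * inverse_fourier F x)" for a b
    proof -
      show "integrable lborel (\<lambda>x. indicator {a..b} x * f x)"
        by (rule Bochner_Integration.integrable_bound[OF f]) (auto split: split_indicator)
      have "integrable lborel (\<lambda>x. indicator {a..b} x *\<^sub>R (LINT \<xi>|lborel. norm (F \<xi>)))"
        by (intro integrable_scaleR_left integrable_real_indicator) (auto simp: emeasure_lborel_Icc_eq)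
      then show "integrable lborel (\<lambda>x. indicator {a..b} x * inverse_fourier F x)"
        by (rule Bochner_Integration.integrable_bound)
          (auto split: split_indicator simp: order_trans[OF norm_inverse_fourier_le])
    qed
    show "integrable lborel (\<lambda>x. indicator {-r..r} x * (f x - inverse_fourier F x))"
      using int by (simp add: right_diff_distrib)
    show "(LINT x|lborel. indicator {a..b} x * (indicator {-r..r} x * (f x - inverse_fourier F x)))
      = 0" for a b
    proof -
      have "(LINT x|lborel. indicator {a..b} x * (indicator {-r..r} x * (f x - inverse_fourier F x)))
        = (LINT x|lborel. indicator {max a (-r)..min b r} x * f x - indicator {max a (-r)..min b r} x * inverse_fourier F x)"
        by (intro Bochner_Integration.integral_cong) (auto split: split_indicator)
      also have "\<dots> = 0"
        using interval_integral_inverse_fourier[OF f F Fi] int by (subst Bochner_Integration.integral_diff) auto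
      finally show ?thesis .
    qed
  qed auto
  then have "AE x in lborel. \<forall>n::nat. indicator {-real n..real n} x * (f x - inverse_fourier F x) = 0"
    by (subst AE_all_countable) blast
  then show ?thesis
  proof eventually_elim
    case (elim x)
    obtain n :: nat where "\<bar>x\<bar> \<le> real n" using real_arch_simple by blast
    with elim[rule_format, of n] show ?case by (auto simp: indicator_def split: if_splits)
  qed
qed

section \<open>Densities of complex measures\<close>

definition sigma_additive :: "(real set \<Rightarrow> 'a::real_normed_vector) \<Rightarrow> bool" where
  "sigma_additive \<nu> \<longleftrightarrow> (\<forall>E :: nat \<Rightarrow> real set. range E \<subseteq> sets borel \<and> disjoint_family E \<longrightarrow>
        (\<lambda>i. \<nu> (E i)) sums \<nu> (\<Union>i. E i))"

lemma sigma_additive_empty: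
  assumes "sigma_additive \<nu>" shows "\<nu> {} = 0"
proof -
  have "(\<lambda>i::nat. \<nu> {}) sums \<nu> (\<Union>i::nat. {})"
    using assms unfolding sigma_additive_def by (elim allE[of _ "\<lambda>_. {}"])
      (auto simp: disjoint_family_on_def)
  then have "(\<lambda>i::nat. \<nu> {}) \<longlonglongrightarrow> 0" by (intro summable_LIMSEQ_zero sums_summable)
  then show ?thesis by (simp add: LIMSEQ_const_iff)
qed

lemma sigma_additive_union:
  assumes "sigma_additive \<nu>" "A \<in> sets borel" "B \<in> sets borel" "A \<inter> B = {}"
  shows "\<nu> (A \<union> B) = \<nu> A + \<nu> B"
proof -
  have "(\<lambda>i. \<nu> (binaryset A B i)) sums \<nu> (\<Union>i. binaryset A B i)"
    using assms unfolding sigma_additive_def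
    by (elim allE[of _ "binaryset A B"])
      (auto simp: disjoint_family_on_def binaryset_def split: if_splits)
  moreover have "(\<lambda>i. \<nu> (binaryset A B i)) sums (\<nu> A + \<nu> B)"
    by (rule binaryset_sums) (rule sigma_additive_empty[OF assms(1)])
  ultimately show ?thesis by (simp add: UN_binaryset_eq sums_unique2)
qed

lemma sigma_additive_Diff:
  fixes \<nu> :: "real set \<Rightarrow> 'a::real_normed_vector"
  assumes "sigma_additive \<nu>" "A \<in> sets borel" "B \<in> sets borel" "B \<subseteq> A"
  shows "\<nu> (A - B) = \<nu> A - \<nu> B"
  using sigma_additive_union[of \<nu> B "A - B"] assms by (simp add: Un_absorb1 algebra_simps)

lemma borel_UNIV: "UNIV \<in> sets borel"
  using sets.top[of borel] by simp

text \<open>The content is that \<open>A \<mapsto> sup {\<nu> B | B \<subseteq> A}\<close> is countably additive, so that \<^const>\<open>measure_of\<close> does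
  not fall back to the zero measure.  For disjoint sets, uniting near-maximal subsets gives
  superadditivity; cutting a subset of the union into its pieces gives the converse inequality.\<close>

lemma emeasure_positive_part:
  assumes \<nu>: "sigma_additive \<nu>" and A: "A \<in> sets borel"
  shows "emeasure (positive_part \<nu>) A = (SUP B \<in> {B \<in> sets borel. B \<subseteq> A}. ennreal (\<nu> B))"
proof -
  define p where "p A = (SUP B \<in> {B \<in> sets borel. B \<subseteq> A}. ennreal (\<nu> B))" for A
  have upper: "ennreal (\<nu> B) \<le> p A" if "B \<in> sets borel" "B \<subseteq> A" for A B
    unfolding p_def using that by (intro SUP_upper) auto
  have pmono: "p A \<le> p B" if "A \<subseteq> B" for A B
    unfolding p_def using that by (intro SUP_subset_mono) auto
  have pempty: "p {} = 0"
    unfolding p_def using sigma_additive_empty[OF \<nu>] by (auto simp: cong: conj_cong)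
  have super: "p A + p B \<le> p (A \<union> B)" if AB: "A \<in> sets borel" "B \<in> sets borel" "A \<inter> B = {}" for A B
  proof -
    have 1: "ennreal (\<nu> A') + ennreal (\<nu> B') \<le> p (A \<union> B)"
      if "A' \<in> sets borel" "A' \<subseteq> A" "B' \<in> sets borel" "B' \<subseteq> B" for A' B'
    proof (cases "0 \<le> \<nu> A' \<and> 0 \<le> \<nu> B'")
      case True
      then have "ennreal (\<nu> A') + ennreal (\<nu> B') = ennreal (\<nu> (A' \<union> B'))"
        using sigma_additive_union[OF \<nu>, of A' B'] that AB by (subst sigma_additive_union[OF \<nu>]) auto
      then show ?thesis using that upper[of "A' \<union> B'" "A \<union> B"] by auto
    next
      case False
      then show ?thesis using that upper[of A' "A \<union> B"] upper[of B' "A \<union> B"] by (auto simp: ennreal_neg le_supI1 le_supI2)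
    qed
    have "p A + p B = (SUP A' \<in> {A' \<in> sets borel. A' \<subseteq> A}. ennreal (\<nu> A') + p B)"
      unfolding p_def by (subst ennreal_SUP_add_left) auto
    also have "\<dots> \<le> p (A \<union> B)"
    proof (rule SUP_least)
      fix A' assume A': "A' \<in> {A' \<in> sets borel. A' \<subseteq> A}"
      have "ennreal (\<nu> A') + p B = (SUP B' \<in> {B' \<in> sets borel. B' \<subseteq> B}. ennreal (\<nu> A') + ennreal (\<nu> B'))"
        unfolding p_def by (subst ennreal_SUP_add_right) auto
      also have "\<dots> \<le> p (A \<union> B)" using A' by (intro SUP_least 1) auto
      finally show "ennreal (\<nu> A') + p B \<le> p (A \<union> B)" .
    qed
    finally show ?thesis .
  qed
  have "countably_additive (sets borel) p"
    unfolding countably_additive_def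
  proof (intro allI impI antisym)
    fix E :: "nat \<Rightarrow> real set" assume E: "range E \<subseteq> sets borel" "disjoint_family E" "\<Union> (range E) \<in> sets borel"
    have "sum (\<lambda>i. p (E i)) {..<n} \<le> p (\<Union>i<n. E i)" for n
    proof (induction n)
      case 0 then show ?case by (simp add: pempty)
    next
      case (Suc n)
      have "sum (\<lambda>i. p (E i)) {..<Suc n} \<le> p (\<Union>i<n. E i) + p (E n)"
        using Suc by (simp add: add_right_mono)
      also have "\<dots> \<le> p ((\<Union>i<n. E i) \<union> E n)"
      proof (rule super)
        show "(\<Union>i<n. E i) \<inter> E n = {}"
        proof (rule equals0I)
          fix x assume "x \<in> (\<Union>i<n. E i) \<inter> E n"
          then obtain i where "i < n" "x \<in> E i \<inter> E n" by auto
          then show False using disjoint_family_onD[OF E(2), of i n] by auto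
        qed
      qed (use E in auto)
      also have "(\<Union>i<n. E i) \<union> E n = (\<Union>i<Suc n. E i)" by (auto simp: lessThan_Suc)
      finally show ?case .
    qed
    then have "sum (\<lambda>i. p (E i)) {..<n} \<le> p (\<Union>i. E i)" for n
      by (rule order_trans) (intro pmono; auto)
    then show "(\<Sum>i. p (E i)) \<le> p (\<Union> (range E))"
      unfolding suminf_eq_SUP by (intro SUP_least)
    show "p (\<Union> (range E)) \<le> (\<Sum>i. p (E i))"
      unfolding p_def[of "\<Union> (range E)"]
    proof (rule SUP_least)
      fix B assume B: "B \<in> {B \<in> sets borel. B \<subseteq> \<Union> (range E)}"
      have "(\<lambda>i. \<nu> (E i \<inter> B)) sums \<nu> (\<Union>i. E i \<inter> B)"
        using \<nu> E B unfolding sigma_additive_def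
        by (elim allE[of _ "\<lambda>i. E i \<inter> B"]) (auto simp: disjoint_family_on_def)
      moreover have "(\<Union>i. E i \<inter> B) = B" using B by auto
      ultimately have s: "(\<lambda>i. \<nu> (E i \<inter> B)) sums \<nu> B" by simp
      show "ennreal (\<nu> B) \<le> (\<Sum>i. p (E i))"
      proof (rule LIMSEQ_le_const2)
        show "(\<lambda>n. ennreal (\<Sum>i<n. \<nu> (E i \<inter> B))) \<longlonglongrightarrow> ennreal (\<nu> B)"
          using s unfolding sums_def by (rule tendsto_ennrealI)
        have "ennreal (\<Sum>i<n. \<nu> (E i \<inter> B)) \<le> (\<Sum>i. p (E i))" for n
        proof -
          have "ennreal (\<Sum>i<n. \<nu> (E i \<inter> B)) \<le> ennreal (\<Sum>i<n. max 0 (\<nu> (E i \<inter> B)))"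
            by (intro ennreal_leI sum_mono) auto
          also have "\<dots> = (\<Sum>i<n. ennreal (max 0 (\<nu> (E i \<inter> B))))" by (rule sum_ennreal[symmetric]) auto
          also have "\<dots> \<le> (\<Sum>i<n. p (E i))"
            using upper[of "E _ \<inter> B" "E _"] E B by (intro sum_mono) (auto simp: max_def)
          also have "\<dots> \<le> (\<Sum>i. p (E i))" by (intro sum_le_suminf) auto
          finally show ?thesis .
        qed
        then show "\<exists>N. \<forall>n\<ge>N. ennreal (\<Sum>i<n. \<nu> (E i \<inter> B)) \<le> (\<Sum>i. p (E i))" by blast
      qed
    qed
  qed
  then have "emeasure (measure_of UNIV (sets borel) p) A = p A"
    using A pempty
    by (intro emeasure_measure_of_sigma)
      (auto simp: positive_def sets.sigma_algebra_axioms[of borel, simplified])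
  then show ?thesis unfolding positive_part_def p_def .
qed

lemma sets_positive_part [measurable_cong, simp]: "sets (positive_part \<nu>) = sets borel"
  unfolding positive_part_def by (simp add: sets.sigma_sets_eq[of borel, simplified])

lemma space_positive_part [simp]: "space (positive_part \<nu>) = UNIV"
  unfolding positive_part_def by (simp add: space_measure_of_conv)

lemma sigma_additive_uminus: "sigma_additive \<nu> \<Longrightarrow> sigma_additive (\<lambda>A. - \<nu> A)"
  unfolding sigma_additive_def by (auto intro: sums_minus)

lemma finite_measure_positive_part:
  assumes "sigma_additive \<nu>" "\<And>A. A \<in> sets borel \<Longrightarrow> \<nu> A \<le> K"
  shows "finite_measure (positive_part \<nu>)"
proof (rule finite_measureI)
  have "emeasure (positive_part \<nu>) UNIV \<le> ennreal K"
    unfolding emeasure_positive_part[OF assms(1) borel_UNIV]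
    using assms(2) by (intro SUP_least ennreal_leI) auto
  then show "emeasure (positive_part \<nu>) (space (positive_part \<nu>)) \<noteq> \<infinity>"
    by (auto simp: top_unique)
qed

text \<open>For \<open>B \<subseteq> A\<close> we have \<open>\<nu> B = \<nu> A - \<nu> (A - B)\<close>.  Taking suprema over \<open>B\<close> gives one inequality between
  the two parts, and exchanging the roles of \<open>\<nu>\<close> and \<open>- \<nu>\<close> gives the other.\<close>

lemma Jordan_decomposition:
  assumes \<nu>: "sigma_additive \<nu>" and K: "\<And>A. A \<in> sets borel \<Longrightarrow> \<bar>\<nu> A\<bar> \<le> K" and A: "A \<in> sets borel"
  shows "\<nu> A = measure (positive_part \<nu>) A - measure (positive_part (\<lambda>A. - \<nu> A)) A"
proof -
  interpret P: finite_measure "positive_part \<nu>"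
    using K by (intro finite_measure_positive_part[OF \<nu>, of K]) (auto simp: abs_le_iff)
  interpret N: finite_measure "positive_part (\<lambda>A. - \<nu> A)"
    using K by (intro finite_measure_positive_part[OF sigma_additive_uminus[OF \<nu>], of K])
      (auto simp: abs_le_iff)
  note P = emeasure_positive_part[OF \<nu> A] and N = emeasure_positive_part[OF sigma_additive_uminus[OF \<nu>] A]
  have 1: "\<nu> B \<le> measure (positive_part \<nu>) A" if "B \<in> sets borel" "B \<subseteq> A" for B
  proof -
    have "ennreal (\<nu> B) \<le> emeasure (positive_part \<nu>) A" unfolding P using that by (intro SUP_upper) auto
    then show ?thesis unfolding P.emeasure_eq_measure by simp
  qed
  have 2: "- \<nu> B \<le> measure (positive_part (\<lambda>A. - \<nu> A)) A" if "B \<in> sets borel" "B \<subseteq> A" for B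
  proof -
    have "ennreal (- \<nu> B) \<le> emeasure (positive_part (\<lambda>A. - \<nu> A)) A"
      unfolding N using that by (intro SUP_upper) auto
    then show ?thesis unfolding N.emeasure_eq_measure by simp
  qed
  have "measure (positive_part \<nu>) A \<le> measure (positive_part (\<lambda>A. - \<nu> A)) A + \<nu> A"
  proof -
    have nn: "0 \<le> measure (positive_part (\<lambda>A. - \<nu> A)) A + \<nu> A" using 2[OF A] by simp
    have "emeasure (positive_part \<nu>) A \<le> ennreal (measure (positive_part (\<lambda>A. - \<nu> A)) A + \<nu> A)"
      unfolding P
    proof (intro SUP_least ennreal_leI)
      fix B assume B: "B \<in> {B \<in> sets borel. B \<subseteq> A}"
      then show "\<nu> B \<le> measure (positive_part (\<lambda>A. - \<nu> A)) A + \<nu> A"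
        using 2[of "A - B"] A sigma_additive_Diff[OF \<nu> A, of B] by auto
    qed
    then show ?thesis using nn unfolding P.emeasure_eq_measure by simp
  qed
  moreover have "measure (positive_part (\<lambda>A. - \<nu> A)) A \<le> measure (positive_part \<nu>) A - \<nu> A"
  proof -
    have nn: "0 \<le> measure (positive_part \<nu>) A - \<nu> A" using 1[OF A] by simp
    have "emeasure (positive_part (\<lambda>A. - \<nu> A)) A \<le> ennreal (measure (positive_part \<nu>) A - \<nu> A)"
      unfolding N
    proof (intro SUP_least ennreal_leI)
      fix B assume B: "B \<in> {B \<in> sets borel. B \<subseteq> A}"
      then show "- \<nu> B \<le> measure (positive_part \<nu>) A - \<nu> A"
        using 1[of "A - B"] A sigma_additive_Diff[OF \<nu> A, of B] by auto
    qed
    then show ?thesis using nn unfolding N.emeasure_eq_measure by simp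
  qed
  ultimately show ?thesis by simp
qed

lemma norm_le_total_variation:
  assumes "B \<in> sets borel" "A \<in> sets borel" "B \<subseteq> A"
  shows "ennreal (norm (\<mu> B)) \<le> total_variation \<mu> A"
proof -
  define E where "E = binaryset B (A - B)"
  have E0: "E 0 = B" by (simp add: E_def binaryset_def)
  have "range E \<subseteq> sets borel" using assms by (auto simp: E_def binaryset_def)
  moreover have "disjoint_family E"
    by (auto simp: E_def disjoint_family_on_def binaryset_def split: if_splits)
  moreover have "(\<Union>i. E i) = A" unfolding E_def UN_binaryset_eq using assms by blast
  ultimately have "(\<Sum>i. ennreal (norm (\<mu> (E i)))) \<le> total_variation \<mu> A"
    unfolding total_variation_def by (intro SUP_upper) simp
  moreover have "(\<Sum>i\<in>{0}. ennreal (norm (\<mu> (E i)))) \<le> (\<Sum>i. ennreal (norm (\<mu> (E i))))"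
    by (rule sum_le_suminf) simp_all
  ultimately show ?thesis by (simp add: E0)
qed

text \<open>Regularity makes boundedness a compactness argument.  Call a Borel set \<open>bd\<close> if \<open>\<mu>\<close> is bounded on its
  Borel subsets; \<open>bd\<close> passes to finite unions and holds for sets of finite variation and for points.
  Outer regularity at \<open>{x}\<close> gives every point a \<open>bd\<close> neighbourhood, inner regularity of the line
  leaves only a compact set to cover, and finitely many neighbourhoods do that.\<close>

lemma regular_complex_measure_bounded:
  assumes "regular_complex_measure \<mu>"
  obtains K where "\<And>A. A \<in> sets borel \<Longrightarrow> norm (\<mu> A) \<le> K"
proof -
  have sa: "sigma_additive \<mu>"
    using assms unfolding regular_complex_measure_def sigma_additive_def by (rule conjunct1)
  have reg: "\<exists>K U. compact K \<and> open U \<and> K \<subseteq> A \<and> A \<subseteq> U \<and> total_variation \<mu> (U - K) < ennreal 1"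
    if "A \<in> sets borel" for A
  proof -
    have "\<forall>A \<in> sets borel. \<forall>e > 0. \<exists>K U.
        compact K \<and> open U \<and> K \<subseteq> A \<and> A \<subseteq> U \<and> total_variation \<mu> (U - K) < ennreal e"
      using assms unfolding regular_complex_measure_def by (rule conjunct2)
    from this[rule_format, OF that, of 1] show ?thesis by simp
  qed
  define bd where "bd A \<longleftrightarrow> A \<in> sets borel \<and> (\<exists>K. \<forall>B\<in>sets borel. B \<subseteq> A \<longrightarrow> norm (\<mu> B) \<le> K)" for A
  have bd1: "bd (U - K)" if "compact K" "open U" "total_variation \<mu> (U - K) < ennreal 1" for K U
    unfolding bd_def
  proof (intro conjI exI[of _ 1] ballI impI)
    show UK: "U - K \<in> sets borel" using that by (auto simp: borel_compact)
    fix B assume "B \<in> sets borel" "B \<subseteq> U - K"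
    then have "ennreal (norm (\<mu> B)) \<le> total_variation \<mu> (U - K)"
      by (intro norm_le_total_variation UK)
    also have "\<dots> < ennreal 1" by fact
    finally have "ennreal (norm (\<mu> B)) < ennreal 1" .
    then show "norm (\<mu> B) \<le> 1" by (simp add: ennreal_less_iff)
  qed
  have bdUn: "bd (A \<union> B)" if "bd A" "bd B" for A B
  proof -
    obtain k l where kl: "\<And>C. C \<in> sets borel \<Longrightarrow> C \<subseteq> A \<Longrightarrow> norm (\<mu> C) \<le> k" "\<And>C. C \<in> sets borel \<Longrightarrow> C \<subseteq> B
      \<Longrightarrow> norm (\<mu> C) \<le> l"
      using \<open>bd A\<close> \<open>bd B\<close> unfolding bd_def by blast
    have AB: "A \<in> sets borel" "B \<in> sets borel" using that by (auto simp: bd_def)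
    have "norm (\<mu> C) \<le> k + l" if C: "C \<in> sets borel" "C \<subseteq> A \<union> B" for C
    proof -
      have "\<mu> ((C \<inter> A) \<union> (C - A)) = \<mu> (C \<inter> A) + \<mu> (C - A)"
        using C AB by (intro sigma_additive_union[OF sa]) auto
      moreover have "(C \<inter> A) \<union> (C - A) = C" by auto
      ultimately have "norm (\<mu> C) \<le> norm (\<mu> (C \<inter> A)) + norm (\<mu> (C - A))"
        by (simp add: norm_triangle_ineq)
      also have "\<dots> \<le> k + l" using C AB by (intro add_mono kl) auto
      finally show ?thesis .
    qed
    then show ?thesis unfolding bd_def using AB by blast
  qed
  have bdpt: "bd {x}" for x
    unfolding bd_def by (auto intro!: exI[of _ "max (norm (\<mu> {})) (norm (\<mu> {x}))"] simp: subset_singleton_iff)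
  have nbhd: "\<exists>U. open U \<and> x \<in> U \<and> bd U" for x
  proof -
    obtain K U where KU: "compact K" "open U" "K \<subseteq> {x}" "{x} \<subseteq> U" "total_variation \<mu> (U - K) < ennreal 1"
      using reg[of "{x}"] by auto
    have "bd ((U - K) \<union> {x})" by (intro bdUn bd1 KU bdpt)
    moreover have "(U - K) \<union> {x} = U" using KU by auto
    ultimately show ?thesis using KU by auto
  qed
  obtain K where K: "compact K" "total_variation \<mu> (UNIV - K) < ennreal 1"
    using reg[OF borel_UNIV] by (metis top.extremum_uniqueI)
  obtain U where U: "\<And>x. open (U x)" "\<And>x. x \<in> U x" "\<And>x. bd (U x)" using nbhd by metis
  obtain F where F: "finite F" "K \<subseteq> (\<Union>x\<in>F. U x)"
    using compactE_image[of K UNIV U] K(1) U by (metis UNIV_I UN_I subsetI)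
  have "bd (\<Union>x\<in>F. U x)" using F(1)
  proof induction
    case empty
    have "bd (UNIV - UNIV)" unfolding bd_def by auto
    then show ?case by simp
  qed (simp add: bdUn U)
  then have "bd ((UNIV - K) \<union> (\<Union>x\<in>F. U x))" by (intro bdUn bd1 K) auto
  moreover have "(UNIV - K) \<union> (\<Union>x\<in>F. U x) = UNIV" using F by auto
  ultimately show thesis using that unfolding bd_def by auto
qed

text \<open>A bounded complex measure has a density \<open>h\<close> with respect to a finite positive measure \<open>L\<close>, here the
  sum of the four Jordan parts, by the Radon--Nikodym theorem applied to each part.\<close>

lemma complex_measure_density:
  assumes \<mu>: "sigma_additive \<mu>" and K: "\<And>A. A \<in> sets borel \<Longrightarrow> norm (\<mu> A) \<le> K"
  obtains L :: "real measure" and h :: "real \<Rightarrow> complex"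
  where "finite_measure L" "sets L = sets borel" "integrable L h"
    "\<And>A. A \<in> sets borel \<Longrightarrow> \<mu> A = (LINT x|L. indicator A x *\<^sub>R h x)"
    "\<And>f B. f \<in> borel_measurable borel \<Longrightarrow> (\<And>x. norm (f x) \<le> B) \<Longrightarrow> complex_integral \<mu> f
      = (LINT x|L. h x * f x)"
proof -
  \<comment> \<open>the signed measures whose positive parts enter \<^const>\<open>complex_integral\<close>\<close>
  define \<nu> where "\<nu> i A = [Re (\<mu> A), - Re (\<mu> A), Im (\<mu> A), - Im (\<mu> A)] ! i" for i :: nat and A
  have four: "P i" if "i < 4" "P 0" "P 1" "P 2" "P 3" for i :: nat and P
    using that by (auto simp: numeral_eq_Suc less_Suc_eq)
  have re: "sigma_additive (\<lambda>A. Re (\<mu> A))" and im: "sigma_additive (\<lambda>A. Im (\<mu> A))"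
    using \<mu> unfolding sigma_additive_def by (auto intro: sums_Re sums_Im)
  have bre: "\<bar>Re (\<mu> A)\<bar> \<le> K" and bim: "\<bar>Im (\<mu> A)\<bar> \<le> K" if "A \<in> sets borel" for A
    using K[OF that] abs_Re_le_cmod[of "\<mu> A"] abs_Im_le_cmod[of "\<mu> A"] by auto
  have \<nu>sa: "sigma_additive (\<nu> i)" if "i < 4" for i
    using that by (rule four) (auto simp: \<nu>_def[abs_def] re im sigma_additive_uminus)
  have \<nu>K: "\<nu> i A \<le> K" if "i < 4" "A \<in> sets borel" for i A
    using that(1) by (rule four) (use bre[OF that(2)] bim[OF that(2)] in \<open>auto simp: \<nu>_def\<close>)
  define P where "P i = positive_part (\<nu> i)" for i
  have P4: "P 0 = positive_part (\<lambda>A. Re (\<mu> A))" "P 1 = positive_part (\<lambda>A. - Re (\<mu> A))"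
    "P 2 = positive_part (\<lambda>A. Im (\<mu> A))" "P 3 = positive_part (\<lambda>A. - Im (\<mu> A))"
    by (simp_all add: P_def \<nu>_def[abs_def])
  have Pfin: "finite_measure (P i)" if "i < 4" for i
    unfolding P_def using finite_measure_positive_part[OF \<nu>sa[OF that]] \<nu>K[OF that] by blast
  have sP[measurable_cong]: "sets (P i) = sets borel" and spP: "space (P i) = UNIV"
    for i by (auto simp: P_def)
  \<comment> \<open>the sum of the four Jordan parts dominates each of them\<close>
  define L where "L = measure_of UNIV (sets borel) (\<lambda>A. \<Sum>i<4. emeasure (P i) A)"
  have sL[measurable_cong]: "sets L = sets borel" and spL: "space L = UNIV"
    unfolding L_def by (simp_all add: sets.sigma_sets_eq[of borel, simplified] space_measure_of_conv)
  have eL: "emeasure L A = (\<Sum>i<4. emeasure (P i) A)" if "A \<in> sets borel" for A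
    unfolding L_def
  proof (rule emeasure_measure_of_sigma)
    show "countably_additive (sets borel) (\<lambda>A. \<Sum>i<4. emeasure (P i) A)"
      unfolding countably_additive_def
    proof (intro allI impI)
      fix E :: "nat \<Rightarrow> real set" assume E: "range E \<subseteq> sets borel" "disjoint_family E"
      have "(\<Sum>n. \<Sum>i<4. emeasure (P i) (E n)) = (\<Sum>i<4. \<Sum>n. emeasure (P i) (E n))"
        by (rule suminf_sum) auto
      also have "\<dots> = (\<Sum>i<4. emeasure (P i) (\<Union>n. E n))"
        using E by (intro sum.cong refl suminf_emeasure) (auto simp: sP)
      finally show "(\<Sum>n. \<Sum>i<4. emeasure (P i) (E n)) = (\<Sum>i<4. emeasure (P i) (\<Union>n. E n))" .
    qed
  qed (use that in \<open>auto simp: positive_def sets.sigma_algebra_axioms[of borel, simplified]\<close>)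
  have Lfin: "finite_measure L"
  proof (rule finite_measureI)
    show "emeasure L (space L) \<noteq> \<infinity>"
      using finite_measure.emeasure_finite[OF Pfin] by (auto simp: spL eL)
  qed
  interpret L: finite_measure L by fact
  have "\<exists>D. D \<in> borel_measurable L \<and> (\<forall>x. 0 \<le> D x) \<and> P i
    = density L (\<lambda>x. ennreal (D x))" if i4: "i < 4" for i
  proof -
    have ac: "absolutely_continuous L (P i)"
      unfolding absolutely_continuous_def
    proof
      fix A assume "A \<in> null_sets L"
      then have "A \<in> sets borel" "emeasure L A = 0" by (auto simp: null_sets_def sL)
      then show "A \<in> null_sets (P i)" using that by (auto simp: eL null_sets_def sP)
    qed
    obtain D where D: "D \<in> borel_measurable L" "AE x in L. RN_deriv L (P i) x
      = ennreal (D x)" "\<And>x. 0 \<le> D x"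
      using L.real_RN_deriv[OF Pfin[OF i4] ac] by (auto simp: sP sL)
    have "P i = density L (RN_deriv L (P i))"
      using L.density_RN_deriv[OF ac] by (simp add: sP sL)
    also have "\<dots> = density L (\<lambda>x. ennreal (D x))"
      using D by (intro density_cong) auto
    finally show ?thesis using D by blast
  qed
  then obtain D where D[measurable]: "\<And>i. i < 4 \<Longrightarrow> D i \<in> borel_measurable L"
    and D0: "\<And>i x. i < 4 \<Longrightarrow> 0 \<le> D i x" and PD: "\<And>i. i < 4 \<Longrightarrow> P i = density L (\<lambda>x. ennreal (D i x))"
    by metis
  have PI: "integral\<^sup>L (P i) f = (LINT x|L. D i x *\<^sub>R f x)" "integrable L (\<lambda>x. D i x *\<^sub>R f x)"
    if "i < 4" "f \<in> borel_measurable borel" "\<And>x. norm (f x) \<le> B" for i B and f :: "real \<Rightarrow> complex"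
  proof -
    have fm[measurable]: "f \<in> borel_measurable L" using that(2) by simp
    interpret Pi: finite_measure "P i" using Pfin that by simp
    have "integrable (P i) f" using that by (intro Pi.integrable_const_bound[where B=B]) auto
    then show "integrable L (\<lambda>x. D i x *\<^sub>R f x)"
      unfolding PD[OF that(1)] using D D0 that(1) by (subst (asm) integrable_density) auto
    show "integral\<^sup>L (P i) f = (LINT x|L. D i x *\<^sub>R f x)"
      unfolding PD[OF that(1)] using D D0 that(1) by (subst integral_density) auto
  qed
  define h where "h x = complex_of_real (D 0 x) - complex_of_real (D 1 x) + \<i> * (complex_of_real (D 2 x) - complex_of_real (D 3 x))" for x
  have ci: "complex_integral \<mu> f = (LINT x|L. h x * f x)" "integrable L (\<lambda>x. h x * f x)"
    if f: "f \<in> borel_measurable borel" "\<And>x. norm (f x) \<le> B" for f B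
  proof -
    note I = PI[OF _ f]
    have i: "integrable L (\<lambda>x. complex_of_real (D i x) * f x)" if "i < 4" for i
      using I(2)[OF that] by (simp add: scaleR_conv_of_real)
    have eq: "h x * f x = (complex_of_real (D 0 x) * f x - complex_of_real (D 1 x) * f x)
       + \<i> * (complex_of_real (D 2 x) * f x - complex_of_real (D 3 x) * f x)" for x
      by (simp add: h_def algebra_simps)
    show "integrable L (\<lambda>x. h x * f x)" unfolding eq using i by auto
    have "complex_integral \<mu> f
      = (integral\<^sup>L (P 0) f - integral\<^sup>L (P 1) f) + \<i> * (integral\<^sup>L (P 2) f - integral\<^sup>L (P 3) f)"
      unfolding complex_integral_def signed_integral_def P4 by simp
    also have "\<dots> = (LINT x|L. h x * f x)"
      unfolding eq using i by (simp add: I(1) scaleR_conv_of_real)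
    finally show "complex_integral \<mu> f = (LINT x|L. h x * f x)" .
  qed
  show thesis
  proof (rule that[OF Lfin sL])
    show "integrable L h" using ci(2)[of "\<lambda>_. 1" 1] by simp
    show "complex_integral \<mu> f = (LINT x|L. h x * f x)"
      if "f \<in> borel_measurable borel" "\<And>x. norm (f x) \<le> B" for f B using ci(1)[OF that] .
    fix A :: "real set" assume A: "A \<in> sets borel"
    have "integral\<^sup>L (P i) (indicator A :: real \<Rightarrow> complex)
      = complex_of_real (measure (P i) A)" if "i < 4" for i
    proof -
      interpret Pi: finite_measure "P i" using Pfin that by simp
      have "integral\<^sup>L (P i) (indicator A :: real \<Rightarrow> complex)
        = integral\<^sup>L (P i) (\<lambda>x. complex_of_real (indicator A x))"
        by (intro Bochner_Integration.integral_cong) (auto split: split_indicator)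
      also have "\<dots> = complex_of_real (measure (P i) A)"
        using A by (simp add: sP spP)
      finally show ?thesis .
    qed
    then have "complex_integral \<mu> (indicator A) =
       (measure (P 0) A - measure (P 1) A) + \<i> * (measure (P 2) A - measure (P 3) A)"
      unfolding complex_integral_def signed_integral_def P4[symmetric] by simp
    also have "\<dots> = \<mu> A"
      using Jordan_decomposition[OF re bre A] Jordan_decomposition[OF im bim A]
      unfolding P4 by (simp add: complex_eq_iff)
    finally have "\<mu> A = complex_integral \<mu> (indicator A)" by simp
    also have "\<dots> = (LINT x|L. h x * indicator A x)"
      using A by (intro ci(1)[of _ 1]) (auto split: split_indicator)
    also have "\<dots> = (LINT x|L. indicator A x *\<^sub>R h x)"
      by (intro Bochner_Integration.integral_cong) (auto split: split_indicator)
    finally show "\<mu> A = (LINT x|L. indicator A x *\<^sub>R h x)" .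
  qed
qed

text \<open>Cut the values of \<open>h\<close> into squares of side \<open>\<epsilon>\<close> and pull the squares back to a Borel partition \<open>E\<close>.
  On each piece \<open>h\<close> is within \<open>2 \<epsilon>\<close> of a constant, so \<open>\<bar>\<mu> (E i)\<bar>\<close> falls short of the integral of
  \<open>\<bar>h\<bar>\<close> over \<open>E i\<close> by at most \<open>4 \<epsilon> L (E i)\<close>; sum over \<open>i\<close>.\<close>

lemma integral_norm_density_le_total_variation:
  fixes h :: "real \<Rightarrow> complex"
  assumes L: "finite_measure L" "sets L = sets borel" and h: "integrable L h"
    and \<mu>: "\<And>A. A \<in> sets borel \<Longrightarrow> \<mu> A = (LINT x|L. indicator A x *\<^sub>R h x)"
  shows "(\<integral>\<^sup>+x. ennreal (norm (h x)) \<partial>L) \<le> total_variation \<mu> UNIV"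
proof -
  interpret finite_measure L by fact
  note L(2)[measurable_cong]
  have spL: "space L = UNIV" using sets_eq_imp_space_eq[OF L(2)] by simp
  have hm[measurable]: "h \<in> borel_measurable L" using h by auto
  have main: "(\<integral>\<^sup>+x. ennreal (norm (h x)) \<partial>L)
    \<le> total_variation \<mu> UNIV + ennreal (4 * \<epsilon>) * emeasure L UNIV" if \<epsilon>: "0 < \<epsilon>" for \<epsilon>
  proof -
    \<comment> \<open>the grid square containing \<open>h x\<close>; there are countably many, and their numbers index the pieces \<open>E i\<close>\<close>
    define q where "q x = (\<lfloor>Re (h x) / \<epsilon>\<rfloor>, \<lfloor>Im (h x) / \<epsilon>\<rfloor>)" for x
    define E where "E i = {x. q x = from_nat i \<and> to_nat (q x) = i}" for i
    have E[measurable]: "E i \<in> sets borel" for i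
    proof -
      have "{x \<in> space L. \<lfloor>Re (h x) / \<epsilon>\<rfloor> = fst (from_nat i :: int \<times> int) \<and> \<lfloor>Im (h x) / \<epsilon>\<rfloor>
        = snd (from_nat i :: int \<times> int)
           \<and> to_nat (from_nat i :: int \<times> int) = i} \<in> sets L"
        by measurable
      also have "{x \<in> space L. \<lfloor>Re (h x) / \<epsilon>\<rfloor> = fst (from_nat i :: int \<times> int) \<and> \<lfloor>Im (h x) / \<epsilon>\<rfloor>
        = snd (from_nat i :: int \<times> int)
           \<and> to_nat (from_nat i :: int \<times> int) = i} = E i"
        by (auto simp: E_def q_def spL prod_eq_iff)
      finally show ?thesis by (simp add: L(2))
    qed
    have ER: "range E \<subseteq> sets borel" by (auto intro: E)
    have dis: "disjoint_family E" unfolding disjoint_family_on_def E_def by auto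
    have UE: "(\<Union>i. E i) = UNIV" unfolding E_def by auto
    have cell: "(\<integral>\<^sup>+x. ennreal (norm (h x)) * indicator (E i) x \<partial>L)
      \<le> ennreal (norm (\<mu> (E i))) + ennreal (4 * \<epsilon>) * emeasure L (E i)" for i
    proof -
      \<comment> \<open>the lower left corner of the square\<close>
      define c where "c = Complex (\<epsilon> * of_int (fst (from_nat i :: int \<times> int))) (\<epsilon> * of_int (snd (from_nat i :: int \<times> int)))"
      have hc: "norm (h x - c) \<le> 2 * \<epsilon>" if "x \<in> E i" for x
      proof -
        have fl: "\<bar>t - \<epsilon> * of_int \<lfloor>t / \<epsilon>\<rfloor>\<bar> \<le> \<epsilon>" for t :: real
        proof -
          have "\<epsilon> * of_int \<lfloor>t / \<epsilon>\<rfloor> \<le> \<epsilon> * (t / \<epsilon>)"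
            and "\<epsilon> * (t / \<epsilon>) \<le> \<epsilon> * (of_int \<lfloor>t / \<epsilon>\<rfloor> + 1)"
            using \<epsilon> by (intro mult_left_mono; linarith)+
          then show ?thesis using \<epsilon> by (simp add: abs_le_iff distrib_left)
        qed
        have "q x = from_nat i" using that by (simp add: E_def)
        then have "fst (from_nat i :: int \<times> int) = \<lfloor>Re (h x) / \<epsilon>\<rfloor>" "snd (from_nat i :: int \<times> int)
          = \<lfloor>Im (h x) / \<epsilon>\<rfloor>"
          by (auto simp: q_def prod_eq_iff)
        then have "\<bar>Re (h x - c)\<bar> \<le> \<epsilon>" "\<bar>Im (h x - c)\<bar> \<le> \<epsilon>" using fl by (auto simp: c_def)
        then show ?thesis using cmod_le[of "h x - c"] by linarith
      qed
      define m where "m = measure L (E i)"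
      have ih: "integrable L (\<lambda>x. indicator (E i) x *\<^sub>R h x)"
        using h by (intro integrable_mult_indicator) (auto simp: L(2))
      have ii: "integrable L (\<lambda>x. indicator (E i) x *\<^sub>R c)"
        by (intro integrable_mult_indicator) (auto simp: L(2))
      have ic: "(LINT x|L. indicator (E i) x *\<^sub>R c) = m *\<^sub>R c"
        unfolding m_def
        by (intro has_bochner_integral_integral_eq has_bochner_integral_indicator)
           (auto simp: L(2) emeasure_eq_measure)
      have ie: "integrable L (\<lambda>x. indicator (E i) x * r)" for r :: real
        using integrable_mult_indicator[of "E i" L "\<lambda>_. r"] by (auto simp: L(2))
      have "m *\<^sub>R c - \<mu> (E i) = (LINT x|L. indicator (E i) x *\<^sub>R c - indicator (E i) x *\<^sub>R h x)"
        unfolding \<mu>[OF E] using ih ii ic by simp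
      also have "norm \<dots> \<le> (LINT x|L. indicator (E i) x * (2 * \<epsilon>))"
      proof (rule Bochner_Integration.integral_norm_bound_integral)
        show "norm (indicator (E i) x *\<^sub>R c - indicator (E i) x *\<^sub>R h x)
          \<le> indicator (E i) x * (2 * \<epsilon>)" for x
          using hc[of x] by (auto split: split_indicator simp: norm_minus_commute)
      qed (use ih ii ie in auto)
      also have "\<dots> = m * (2 * \<epsilon>)" by (simp add: m_def L(2) spL)
      finally have 1: "m * norm c \<le> norm (\<mu> (E i)) + m * (2 * \<epsilon>)"
        using norm_triangle_ineq2[of "m *\<^sub>R c" "\<mu> (E i)"] by (simp add: m_def)
      have "(\<integral>\<^sup>+x. ennreal (norm (h x)) * indicator (E i) x \<partial>L)
        \<le> (\<integral>\<^sup>+x. ennreal (norm c + 2 * \<epsilon>) * indicator (E i) x \<partial>L)"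
      proof (intro nn_integral_mono)
        fix x show "ennreal (norm (h x)) * indicator (E i) x
          \<le> ennreal (norm c + 2 * \<epsilon>) * indicator (E i) x"
          using hc[of x] norm_triangle_ineq2[of "h x" c] by (auto split: split_indicator intro!: ennreal_leI)
      qed
      also have "\<dots> = ennreal ((norm c + 2 * \<epsilon>) * m)"
        using \<epsilon> by (simp add: nn_integral_cmult_indicator L(2) emeasure_eq_measure m_def ennreal_mult)
      also have "\<dots> \<le> ennreal (norm (\<mu> (E i)) + 4 * \<epsilon> * m)"
        using 1 by (intro ennreal_leI) (simp add: algebra_simps)
      also have "\<dots> = ennreal (norm (\<mu> (E i))) + ennreal (4 * \<epsilon>) * emeasure L (E i)"
        using \<epsilon> by (simp add: emeasure_eq_measure m_def ennreal_mult ennreal_plus)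
      finally show ?thesis .
    qed
    have "(\<integral>\<^sup>+x. ennreal (norm (h x)) \<partial>L) = emeasure (density L (\<lambda>x. ennreal (norm (h x)))) (\<Union>i. E i)"
      by (subst UE, subst emeasure_density) (auto simp: L(2))
    also have "\<dots> = (\<Sum>i. emeasure (density L (\<lambda>x. ennreal (norm (h x)))) (E i))"
      using dis ER by (intro suminf_emeasure[symmetric]) (auto simp: L(2))
    also have "\<dots> = (\<Sum>i. \<integral>\<^sup>+x. ennreal (norm (h x)) * indicator (E i) x \<partial>L)"
      by (intro suminf_cong emeasure_density) (auto simp: L(2))
    also have "\<dots> \<le> (\<Sum>i. ennreal (norm (\<mu> (E i))) + ennreal (4 * \<epsilon>) * emeasure L (E i))"
      by (intro suminf_le cell) auto
    also have "\<dots> = (\<Sum>i. ennreal (norm (\<mu> (E i)))) + ennreal (4 * \<epsilon>) * (\<Sum>i. emeasure L (E i))"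
      by (simp add: suminf_add[symmetric])
    also have "(\<Sum>i. emeasure L (E i)) = emeasure L UNIV"
      using suminf_emeasure[of E L] dis UE ER by (simp add: L(2))
    also have "(\<Sum>i. ennreal (norm (\<mu> (E i)))) \<le> total_variation \<mu> UNIV"
      unfolding total_variation_def using dis UE ER by (intro SUP_upper) auto
    finally show ?thesis by (simp add: add_right_mono)
  qed
  show ?thesis
  proof (rule ennreal_le_epsilon)
    fix e :: real assume e: "0 < e"
    define \<epsilon> where "\<epsilon> = e / (4 * (measure L UNIV + 1))"
    have m0: "0 \<le> measure L UNIV" by simp
    then have \<epsilon>: "0 < \<epsilon>" using e unfolding \<epsilon>_def by (intro divide_pos_pos mult_pos_pos) linarith+
    have "4 * \<epsilon> * measure L UNIV \<le> 4 * \<epsilon> * (measure L UNIV + 1)"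
      using \<epsilon> by (intro mult_left_mono) auto
    also have "\<dots> = e"
    proof -
      have "4 * (e / (4 * m)) * m = e" if "m \<noteq> 0" for m :: real using that by simp
      moreover have "measure L UNIV + 1 \<noteq> 0" using m0 by linarith
      ultimately show ?thesis unfolding \<epsilon>_def by blast
    qed
    finally have "4 * \<epsilon> * measure L UNIV \<le> e" .
    then have "ennreal (4 * \<epsilon>) * emeasure L UNIV \<le> ennreal e"
      using \<epsilon> by (simp add: emeasure_eq_measure ennreal_mult[symmetric] ennreal_leI)
    then show "(\<integral>\<^sup>+x. ennreal (norm (h x)) \<partial>L) \<le> total_variation \<mu> UNIV + ennreal e"
      using main[OF \<epsilon>] by (meson add_left_mono order_trans)
  qed
qed

section \<open>Bilinear multipliers given by measures\<close>

lemma lebesgue_measurable_imp_borel_AE: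
  fixes f :: "real \<Rightarrow> complex"
  assumes "f \<in> borel_measurable lebesgue"
  obtains f' where "f' \<in> borel_measurable borel" "AE x in lebesgue. f x = f' x"
proof -
  have "(\<lambda>x. Re (f x)) \<in> borel_measurable lebesgue" "(\<lambda>x. Im (f x)) \<in> borel_measurable lebesgue"
    using assms by auto
  then obtain u v where u: "u \<in> borel_measurable lborel" "AE x in lborel. Re (f x) = u x"
    and v: "v \<in> borel_measurable lborel" "AE x in lborel. Im (f x) = v x"
    by (blast dest: completion_ex_borel_measurable_real)
  show thesis
  proof (rule that[of "\<lambda>x. Complex (u x) (v x)"])
    have "(\<lambda>x. complex_of_real (u x) + \<i> * complex_of_real (v x)) \<in> borel_measurable borel"
      using u(1) v(1) by auto
    then show "(\<lambda>x. Complex (u x) (v x)) \<in> borel_measurable borel" by (simp add: Complex_eq)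
    have "AE x in lborel. f x = Complex (u x) (v x)"
      using u(2) v(2) by eventually_elim (simp add: complex_eq_iff)
    then show "AE x in lebesgue. f x = Complex (u x) (v x)" by (rule AE_completion)
  qed
qed

text \<open>The transform of an integrable function is bounded, and here it has bounded support, so it is
  integrable and Fourier inversion applies to a Borel representative of \<open>f\<close>.\<close>

lemma band_limited_inversion:
  assumes "f \<in> band_limited"
  shows "integrable lborel (fourier f)" and "AE x in lebesgue. f x = inverse_fourier (fourier f) x"
proof -
  have f: "integrable lebesgue f" and c: "compact (closure {\<xi>. fourier f \<xi> \<noteq> 0})"
    using assms by (auto simp: band_limited_def)
  have fm[measurable]: "f \<in> borel_measurable lebesgue" using f by auto
  obtain f' where [measurable]: "f' \<in> borel_measurable borel" and ae: "AE x in lebesgue. f x = f' x"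
    using lebesgue_measurable_imp_borel_AE[OF fm] by blast
  have f'm: "(\<lambda>x. f' x * cis (- 2 * pi * x * \<xi>)) \<in> borel_measurable lborel" for \<xi> by measurable
  have f'l: "f' \<in> borel_measurable lebesgue" by (rule measurable_completion) simp
  have "integrable lebesgue f'" using f integrable_cong_AE[OF fm f'l ae] by blast
  then have f': "integrable lborel f'" by (subst (asm) integrable_completion) auto
  have F: "fourier f = (\<lambda>\<xi>. LINT x|lborel. f' x * cis (- 2 * pi * x * \<xi>))"
  proof
    fix \<xi>
    have cm: "(\<lambda>x. cis (- 2 * pi * x * \<xi>)) \<in> borel_measurable lebesgue"
      by (rule measurable_completion) measurable
    have "fourier f \<xi> = (LINT x|lebesgue. f' x * cis (- 2 * pi * x * \<xi>))"
      unfolding fourier_def using ae cm f'l fm by (intro integral_cong_AE borel_measurable_times) auto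
    also have "\<dots> = (LINT x|lborel. f' x * cis (- 2 * pi * x * \<xi>))"
      by (rule integral_completion) (rule f'm)
    finally show "fourier f \<xi> = (LINT x|lborel. f' x * cis (- 2 * pi * x * \<xi>))" .
  qed
  have Fm[measurable]: "fourier f \<in> borel_measurable borel" unfolding F by measurable
  have Fb: "norm (fourier f \<xi>) \<le> (LINT x|lborel. norm (f' x))" for \<xi>
    using integral_norm_bound[of lborel "\<lambda>x. f' x * cis (- 2 * pi * x * \<xi>)"] by (simp add: F norm_mult)
  obtain r where r: "\<And>\<xi>. \<xi> \<in> closure {\<xi>. fourier f \<xi> \<noteq> 0} \<Longrightarrow> norm \<xi> \<le> r"
    using compact_imp_bounded[OF c] unfolding bounded_iff by blast
  have supp: "\<xi> \<in> {-r..r}" if "fourier f \<xi> \<noteq> 0" for \<xi>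
  proof -
    have "\<xi> \<in> closure {\<xi>. fourier f \<xi> \<noteq> 0}" using that by (intro subsetD[OF closure_subset]) auto
    then show ?thesis using r[of \<xi>] by auto
  qed
  have "integrable lborel (\<lambda>\<xi>. indicator {-r..r} \<xi> *\<^sub>R (LINT x|lborel. norm (f' x)))"
    by (intro integrable_scaleR_left integrable_real_indicator) (auto simp: emeasure_lborel_Icc_eq)
  then show Fi: "integrable lborel (fourier f)"
  proof (rule Bochner_Integration.integrable_bound)
    show "AE \<xi> in lborel. norm (fourier f \<xi>)
      \<le> norm (indicator {-r..r} \<xi> *\<^sub>R (LINT x|lborel. norm (f' x)))"
    proof (rule AE_I2)
      fix \<xi> show "norm (fourier f \<xi>) \<le> norm (indicator {-r..r} \<xi> *\<^sub>R (LINT x|lborel. norm (f' x)))"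
        using supp[of \<xi>] Fb[of \<xi>] by (cases "fourier f \<xi> = 0") auto
    qed
  qed simp
  have "AE x in lebesgue. f' x = inverse_fourier (fourier f) x"
    by (rule AE_completion) (rule fourier_inversion[OF f' F Fi])
  with ae show "AE x in lebesgue. f x = inverse_fourier (fourier f) x"
    by eventually_elim simp
qed

text \<open>Insert the integral for \<open>M (\<xi> - \<eta>)\<close> and integrate over the frequencies first:
  \<open>- t (\<xi> - \<eta>) + (\<xi> + \<eta>) x = \<xi> (x - t) + \<eta> (x + t)\<close>, so the exponential splits and the operator becomes an
  average of products of opposite translates.\<close>

lemma bilinear_multiplier_fourier_transform:
  assumes F: "integrable lborel (fourier f)" and G: "integrable lborel (fourier g)"
    and L: "finite_measure L" "sets L = sets borel" and h: "integrable L h"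
    and M: "\<And>\<xi>. M \<xi> = (LINT t|L. h t * cis (- 2 * pi * t * \<xi>))"
  shows "bilinear_multiplier M f g x
    = (LINT t|L. h t * (inverse_fourier (fourier f) (x - t) * inverse_fourier (fourier g) (x + t)))"
proof -
  interpret L: finite_measure L by fact
  note L(2)[measurable_cong]
  have hm[measurable]: "h \<in> borel_measurable L" using h by auto
  have [measurable]: "fourier f \<in> borel_measurable borel" "fourier g \<in> borel_measurable borel" using F G by auto
  have [measurable]: "M \<in> borel_measurable borel" unfolding M[abs_def] by measurable
  define u where "u = inverse_fourier (fourier f)"
  have um[measurable]: "u \<in> borel_measurable borel" unfolding u_def by measurable
  have inner: "(LINT \<xi>|lebesgue. fourier f \<xi> * fourier g \<eta> * M (\<xi> - \<eta>) * cis (2 * pi * (\<xi> + \<eta>) * x))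
     = fourier g \<eta> * (LINT t|L. (h t * u (x - t)) * cis (2 * pi * \<eta> * (x + t)))" for \<eta>
  proof -
    have "(LINT \<xi>|lebesgue. fourier f \<xi> * fourier g \<eta> * M (\<xi> - \<eta>) * cis (2 * pi * (\<xi> + \<eta>) * x))
      = (LINT \<xi>|lborel. fourier f \<xi> * fourier g \<eta> * M (\<xi> - \<eta>) * cis (2 * pi * (\<xi> + \<eta>) * x))"
      by (rule integral_completion) measurable
    also have "\<dots> = (LINT \<xi>|lborel. fourier g \<eta> * (fourier f \<xi> * (LINT t|L. h t * cis (2 * pi * (\<xi> * (x - t) + \<eta> * (x + t))))))"
    proof (intro Bochner_Integration.integral_cong refl)
      fix \<xi>
      have "M (\<xi> - \<eta>) * cis (2 * pi * (\<xi> + \<eta>) * x)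
        = (LINT t|L. h t * cis (- 2 * pi * t * (\<xi> - \<eta>)) * cis (2 * pi * (\<xi> + \<eta>) * x))"
        unfolding M by simp
      also have "\<dots> = (LINT t|L. h t * cis (2 * pi * (\<xi> * (x - t) + \<eta> * (x + t))))"
        by (intro Bochner_Integration.integral_cong refl)
          (simp add: cis_mult mult.assoc, simp add: algebra_simps)
      finally show "fourier f \<xi> * fourier g \<eta> * M (\<xi> - \<eta>) * cis (2 * pi * (\<xi> + \<eta>) * x)
        = fourier g \<eta> * (fourier f \<xi> * (LINT t|L. h t * cis (2 * pi * (\<xi> * (x - t) + \<eta> * (x + t)))))"
        by (simp add: mult.assoc mult.left_commute)
    qed
    also have "\<dots> = fourier g \<eta> * (LINT \<xi>|lborel. fourier f \<xi> * (LINT t|L. h t * cis (2 * pi * (\<xi> * (x - t) + \<eta> * (x + t)))))"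
      by (rule integral_mult_right_zero)
    also have "(LINT \<xi>|lborel. fourier f \<xi> * (LINT t|L. h t * cis (2 * pi * (\<xi> * (x - t) + \<eta> * (x + t)))))
      = (LINT t|L. h t * (LINT \<xi>|lborel. fourier f \<xi> * cis (2 * pi * (\<xi> * (x - t) + \<eta> * (x + t)))))"
      by (rule integral_swap_bounded_kernel[where B=1])
         (auto simp: F h lborel.sigma_finite_measure_axioms L.sigma_finite_measure_axioms)
    also have "\<dots> = (LINT t|L. (h t * u (x - t)) * cis (2 * pi * \<eta> * (x + t)))"
    proof (intro Bochner_Integration.integral_cong refl)
      fix t
      have "(LINT \<xi>|lborel. fourier f \<xi> * cis (2 * pi * (\<xi> * (x - t) + \<eta> * (x + t))))
        = (LINT \<xi>|lborel. fourier f \<xi> * cis (2 * pi * \<xi> * (x - t)) * cis (2 * pi * \<eta> * (x + t)))"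
        by (intro Bochner_Integration.integral_cong refl)
          (simp add: cis_mult mult.assoc, simp add: algebra_simps)
      also have "\<dots> = u (x - t) * cis (2 * pi * \<eta> * (x + t))"
        unfolding u_def inverse_fourier_def by (rule integral_mult_left_zero)
      finally show "h t * (LINT \<xi>|lborel. fourier f \<xi> * cis (2 * pi * (\<xi> * (x - t) + \<eta> * (x + t))))
         = (h t * u (x - t)) * cis (2 * pi * \<eta> * (x + t))" by simp
    qed
    finally show ?thesis .
  qed
  have hu: "integrable L (\<lambda>t. h t * u (x - t))"
  proof (rule Bochner_Integration.integrable_bound[where f="\<lambda>t. norm (h t) * (LINT \<xi>|lborel. norm (fourier f \<xi>))"])
    show "AE t in L. norm (h t * u (x - t)) \<le> norm (norm (h t) * (LINT \<xi>|lborel. norm (fourier f \<xi>)))"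
      using norm_inverse_fourier_le[of "fourier f"] by (auto simp: u_def norm_mult intro!: mult_left_mono order_trans[OF _ abs_ge_self])
  qed (use h in auto)
  have "bilinear_multiplier M f g x
    = (LINT \<eta>|lebesgue. fourier g \<eta> * (LINT t|L. (h t * u (x - t)) * cis (2 * pi * \<eta> * (x + t))))"
    unfolding bilinear_multiplier_def inner ..
  also have "\<dots> = (LINT \<eta>|lborel. fourier g \<eta> * (LINT t|L. (h t * u (x - t)) * cis (2 * pi * \<eta> * (x + t))))"
    by (rule integral_completion) measurable
  also have "\<dots> = (LINT t|L. (h t * u (x - t)) * (LINT \<eta>|lborel. fourier g \<eta> * cis (2 * pi * \<eta> * (x + t))))"
    by (rule integral_swap_bounded_kernel[where B=1])
       (auto simp: G hu lborel.sigma_finite_measure_axioms L.sigma_finite_measure_axioms)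
  finally show ?thesis by (simp add: u_def inverse_fourier_def mult.assoc)
qed

text \<open>Normalise \<open>\<bar>h\<bar> L\<close> to a probability measure \<open>P\<close>.  Jensen's inequality moves \<open>\<Phi>3\<close> inside the average over \<open>t\<close>,
  the pointwise Hoelder inequality splits the product, and translation invariance of Lebesgue measure
  bounds the modular by \<open>(1 + 1) / 2\<close>.  One factor \<open>\<rho>\<close> pays for the strict inequality required by
  Jensen's inequality and the other for the one required by the pointwise bound.\<close>

lemma luxemburg_norm_bilinear_average_le:
  fixes u v :: "real \<Rightarrow> complex"
  assumes y: "young_function \<Phi>1" "young_function \<Phi>2" "young_function \<Phi>3"
    and inv: "\<And>x. 0 \<le> x \<Longrightarrow> young_inverse \<Phi>1 x * young_inverse \<Phi>2 x \<le> young_inverse \<Phi>3 x"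
    and u[measurable]: "u \<in> borel_measurable borel" and v[measurable]: "v \<in> borel_measurable borel"
    and L: "finite_measure L" "sets L = sets borel" and h: "integrable L h"
    and T: "T = (LINT t|L. norm (h t))" "0 < T"
    and a: "0 < a" "(\<integral>\<^sup>+x. \<Phi>1 (norm (u x) / a) \<partial>lebesgue) \<le> 1"
    and b: "0 < b" "(\<integral>\<^sup>+x. \<Phi>2 (norm (v x) / b) \<partial>lebesgue) \<le> 1"
    and \<rho>: "0 < \<rho>" "\<rho> < 1"
  shows "luxemburg_norm \<Phi>3 (\<lambda>x. LINT t|L. h t * (u (x - t) * v (x + t))) \<le> ennreal (2 * T * a * b / \<rho>\<^sup>2)"
proof (rule luxemburg_norm_upper)
  define c where "c = 2 * T * a * b / \<rho>\<^sup>2"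
  show c0: "0 < 2 * T * a * b / \<rho>\<^sup>2" using T a b \<rho> by simp
  note young_comp_borel[OF y(1), measurable] young_comp_borel[OF y(2), measurable] young_comp_borel[OF y(3), measurable]
  interpret L: finite_measure L by fact
  note L(2)[measurable_cong]
  have hm[measurable]: "h \<in> borel_measurable L" using h by auto
  define P where "P = density L (\<lambda>t. ennreal (norm (h t) / T))"
  have sP[measurable_cong]: "sets P = sets borel" by (simp add: P_def L(2))
  have "prob_space P"
  proof (rule prob_spaceI)
    have "emeasure P (space P) = (\<integral>\<^sup>+t. ennreal (norm (h t) / T) \<partial>L)"
      unfolding P_def by (subst emeasure_density) (auto intro!: nn_integral_cong split: split_indicator)
    also have "\<dots> = ennreal (LINT t|L. norm (h t) / T)"
      using h T by (intro nn_integral_eq_integral) auto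
    also have "(LINT t|L. norm (h t) / T) = 1" using T by simp
    finally show "emeasure P (space P) = 1" by simp
  qed
  then interpret P: prob_space P .
  define U where "U x = \<Phi>1 (norm (u x) / a)" for x
  define V where "V x = \<Phi>2 (norm (v x) / b)" for x
  have [measurable]: "U \<in> borel_measurable borel" "V \<in> borel_measurable borel"
    unfolding U_def V_def by measurable
  define B where "B x = (LINT t|L. h t * (u (x - t) * v (x + t)))" for x
  have point: "\<Phi>3 (norm (B x) / c) \<le> (\<integral>\<^sup>+t. ennreal (1/2) * (U (x - t) + V (x + t)) \<partial>P)" for x
  proof (cases "B x = 0")
    case True then show ?thesis using y(3) by (simp add: young_function_def)
  next
    case False
    define X where "X t = \<rho> * ((norm (u (x - t)) / a) * (norm (v (x + t)) / b)) / 2" for t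
    have Xm[measurable]: "X \<in> borel_measurable P" unfolding X_def by measurable
    \<comment> \<open>the factor between \<open>\<bar>h u v\<bar>\<close> and \<open>X\<close> times the density of \<open>P\<close>; note \<open>k = \<rho> c < c\<close>\<close>
    define k where "k = 2 * a * b * T / \<rho>"
    have k: "0 < k" using a b T \<rho> by (simp add: k_def)
    have int: "integrable L (\<lambda>t. h t * (u (x - t) * v (x + t)))"
      using False not_integrable_integral_eq unfolding B_def by blast
    have "ennreal (norm (B x)) \<le> (\<integral>\<^sup>+t. ennreal (norm (h t * (u (x - t) * v (x + t)))) \<partial>L)"
      unfolding B_def by (rule integral_norm_bound_ennreal[OF int])
    also have "\<dots> = (\<integral>\<^sup>+t. ennreal k * (ennreal (norm (h t) / T) * ennreal (X t)) \<partial>L)"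
    proof (intro nn_integral_cong)
      fix t
      have nn: "0 \<le> k" "0 \<le> norm (h t) / T" "0 \<le> X t"
        using k T a b \<rho> by (auto simp: X_def)
      have "norm (h t * (u (x - t) * v (x + t))) = k * (norm (h t) / T * X t)"
        using a b T \<rho> by (simp add: k_def X_def norm_mult)
      then show "ennreal (norm (h t * (u (x - t) * v (x + t))))
        = ennreal k * (ennreal (norm (h t) / T) * ennreal (X t))"
        by (simp only: ennreal_mult[OF nn(1) mult_nonneg_nonneg[OF nn(2,3)]] ennreal_mult[OF nn(2,3)])
    qed
    also have "\<dots> = ennreal k * (\<integral>\<^sup>+t. ennreal (norm (h t) / T) * ennreal (X t) \<partial>L)"
      unfolding X_def by (intro nn_integral_cmult) measurable
    also have "(\<integral>\<^sup>+t. ennreal (norm (h t) / T) * ennreal (X t) \<partial>L) = (\<integral>\<^sup>+t. ennreal (X t) \<partial>P)"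
      unfolding P_def X_def by (intro nn_integral_density[symmetric]) measurable
    finally have le: "ennreal (norm (B x)) \<le> ennreal k * (\<integral>\<^sup>+t. ennreal (X t) \<partial>P)" .
    have "ennreal (norm (B x) / k) \<le> (\<integral>\<^sup>+t. ennreal (X t) \<partial>P)"
    proof (cases "\<integral>\<^sup>+t. ennreal (X t) \<partial>P")
      case (real j)
      then have "norm (B x) \<le> k * j" using le k by (simp add: ennreal_mult[symmetric])
      then show ?thesis using real k by (auto intro!: ennreal_leI simp: field_simps)
    qed simp
    moreover have "norm (B x) / c < norm (B x) / k"
    proof -
      have "k < c"
        using a b T \<rho> by (simp add: k_def c_def power2_eq_square field_simps)
      then show ?thesis using False k by (intro divide_strict_left_mono) auto
    qed
    then have "ennreal (norm (B x) / c) < ennreal (norm (B x) / k)"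
      using divide_nonneg_pos[OF norm_ge_zero c0[folded c_def]] by (subst ennreal_less_iff)
    ultimately have "ennreal (norm (B x) / c) < (\<integral>\<^sup>+t. ennreal (X t) \<partial>P)"
      by (rule order_less_le_trans[rotated])
    then have "\<Phi>3 (norm (B x) / c) \<le> (\<integral>\<^sup>+t. \<Phi>3 (X t) \<partial>P)"
      using c0 a b \<rho> by (intro young_Jensen[OF y(3) \<open>prob_space P\<close>]) (auto simp: c_def[symmetric] X_def)
    also have "\<dots> \<le> (\<integral>\<^sup>+t. ennreal (1/2) * (U (x - t) + V (x + t)) \<partial>P)"
      unfolding X_def U_def V_def using a b \<rho> by (intro nn_integral_mono young_half_product_le[OF y inv]) auto
    finally show ?thesis .
  qed
  interpret pair_sigma_finite lborel P ..
  have "(\<integral>\<^sup>+x. \<Phi>3 (norm (B x) / c) \<partial>lebesgue)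
    \<le> (\<integral>\<^sup>+x. (\<integral>\<^sup>+t. ennreal (1/2) * (U (x - t) + V (x + t)) \<partial>P) \<partial>lborel)"
    unfolding nn_integral_completion by (intro nn_integral_mono point)
  also have "\<dots> = (\<integral>\<^sup>+t. (\<integral>\<^sup>+x. ennreal (1/2) * (U (x - t) + V (x + t)) \<partial>lborel) \<partial>P)"
    by (rule Fubini'[symmetric]) measurable
  also have "\<dots> \<le> (\<integral>\<^sup>+t. 1 \<partial>P)"
  proof (intro nn_integral_mono)
    fix t
    have "(\<integral>\<^sup>+x. ennreal (1/2) * (U (x - t) + V (x + t)) \<partial>lborel)
       = ennreal (1/2) * ((\<integral>\<^sup>+x. U (x - t) \<partial>lborel) + (\<integral>\<^sup>+x. V (x + t) \<partial>lborel))"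
      by (simp add: nn_integral_cmult nn_integral_add)
    also have "(\<integral>\<^sup>+x. U (x - t) \<partial>lborel) = (\<integral>\<^sup>+x. U x \<partial>lborel)"
      using nn_integral_real_affine[of U 1 "-t"] by (simp add: algebra_simps)
    also have "(\<integral>\<^sup>+x. V (x + t) \<partial>lborel) = (\<integral>\<^sup>+x. V x \<partial>lborel)"
      using nn_integral_real_affine[of V 1 t] by (simp add: algebra_simps)
    also have "ennreal (1/2) * ((\<integral>\<^sup>+x. U x \<partial>lborel) + (\<integral>\<^sup>+x. V x \<partial>lborel)) \<le> ennreal (1/2) * (1 + 1)"
      using a(2) b(2) unfolding U_def V_def nn_integral_completion by (intro mult_left_mono add_mono) auto
    also have "\<dots> = ennreal (1/2) * ennreal 2" by simp
    also have "\<dots> = 1" by (subst ennreal_mult[symmetric]) auto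
    finally show "(\<integral>\<^sup>+x. ennreal (1/2) * (U (x - t) + V (x + t)) \<partial>lborel) \<le> 1" .
  qed
  also have "\<dots> = 1" by (simp add: P.emeasure_space_1)
  finally show "(\<integral>\<^sup>+x. \<Phi>3 (norm (LINT t|L. h t * (u (x - t) * v (x + t))) / (2 * T * a * b / \<rho>\<^sup>2)) \<partial>lebesgue) \<le> 1"
    by (simp add: B_def c_def)
qed

text \<open>By homogeneity and the previous lemma the bound holds with \<open>2 T / \<rho>\<^sup>4\<close> for all \<open>\<rho> < 1\<close>, where \<open>T\<close> is the
  \<open>L\<close>-integral of \<open>\<bar>h\<bar>\<close>; let \<open>\<rho>\<close> tend to \<open>1\<close>.  Vanishing norms are treated apart, because the product
  with an infinite norm is \<open>0\<close>: in that case one of the functions is null and so is the operator.\<close>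

lemma multiplier_bound_fourier_transform:
  assumes y: "young_function \<Phi>1" "young_function \<Phi>2" "young_function \<Phi>3"
    and inv: "\<And>x. 0 \<le> x \<Longrightarrow> young_inverse \<Phi>1 x * young_inverse \<Phi>2 x \<le> young_inverse \<Phi>3 x"
    and L: "finite_measure L" "sets L = sets borel" and h: "integrable L h"
    and M: "\<And>\<xi>. M \<xi> = (LINT t|L. h t * cis (- 2 * pi * t * \<xi>))"
    and C: "0 < C" "2 * (LINT t|L. norm (h t)) \<le> C"
  shows "multiplier_bound \<Phi>1 \<Phi>2 \<Phi>3 M C"
  unfolding multiplier_bound_def
proof (intro conjI ballI C(1))
  fix f g assume fg: "f \<in> band_limited" "g \<in> band_limited"
  define T where "T = (LINT t|L. norm (h t))"
  have T0: "0 \<le> T" by (simp add: T_def)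
  define N1 N2 where "N1 = luxemburg_norm \<Phi>1 f" and "N2 = luxemburg_norm \<Phi>2 g"
  note Fi = band_limited_inversion[OF fg(1)] and Gi = band_limited_inversion[OF fg(2)]
  have fourier0: "fourier k = (\<lambda>\<xi>. 0)"
    if "k \<in> band_limited" "young_function \<Phi>" "luxemburg_norm \<Phi> k = 0" for k \<Phi>
  proof
    fix \<xi>
    have "k \<in> borel_measurable lebesgue" using that(1) by (auto simp: band_limited_def)
    then have "AE x in lebesgue. k x = 0" using luxemburg_norm_eq_0_imp[OF that(2) _ that(3)] by blast
    then have "AE x in lebesgue. k x * cis (- 2 * pi * x * \<xi>) = 0" by eventually_elim simp
    then show "fourier k \<xi> = 0" unfolding fourier_def by (rule integral_eq_zero_AE)
  qed
  note conv = bilinear_multiplier_fourier_transform[OF Fi(1) Gi(1) L h M]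
  consider "N1 = 0 \<or> N2 = 0 \<or> T = 0" | "N1 \<noteq> 0" "N2 \<noteq> 0" "N1 = \<infinity> \<or> N2 = \<infinity>"
    | n1 n2 where "N1 = ennreal n1" "N2 = ennreal n2" "0 < n1" "0 < n2" "0 < T"
    using T0 by (cases N1; cases N2) (auto simp: less_le)
  then have "luxemburg_norm \<Phi>3 (bilinear_multiplier M f g) \<le> ennreal C * N1 * N2"
  proof cases
    case 1
    have "bilinear_multiplier M f g x = 0" for x
      using 1
    proof (elim disjE)
      assume "T = 0"
      then have "AE t in L. norm (h t) = 0"
        using h unfolding T_def by (subst (asm) integral_nonneg_eq_0_iff_AE) auto
      then show ?thesis unfolding conv by (intro integral_eq_zero_AE) auto
    qed (auto simp: bilinear_multiplier_def N1_def N2_def fourier0[OF fg(1) y(1)] fourier0[OF fg(2) y(2)])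
    then have "bilinear_multiplier M f g = (\<lambda>x. 0)" by auto
    then show ?thesis by (simp add: luxemburg_norm_zero[OF y(3)])
  next
    case 2
    then have "ennreal C * N1 * N2 = \<infinity>" using C(1) by (auto simp: ennreal_mult_eq_top_iff)
    then show ?thesis by simp
  next
    case (3 n1 n2)
    define u v where "u = inverse_fourier (fourier f)" and "v = inverse_fourier (fourier g)"
    have m: "u \<in> borel_measurable borel" "v \<in> borel_measurable borel"
      using Fi(1) Gi(1) unfolding u_def v_def by (auto intro!: inverse_fourier_borel)
    have N: "luxemburg_norm \<Phi>1 u = ennreal n1" "luxemburg_norm \<Phi>2 v = ennreal n2"
      using 3 luxemburg_norm_AE_cong[OF Fi(2)] luxemburg_norm_AE_cong[OF Gi(2)] by (auto simp: N1_def N2_def u_def v_def)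
    have B: "bilinear_multiplier M f g = (\<lambda>x. LINT t|L. h t * (u (x - t) * v (x + t)))"
      by (auto simp: conv u_def v_def)
    have bound: "luxemburg_norm \<Phi>3 (bilinear_multiplier M f g)
      \<le> ennreal (2 * T * (n1 / \<rho>) * (n2 / \<rho>) / \<rho>\<^sup>2)"
      if \<rho>: "0 < \<rho>" "\<rho> < 1" for \<rho>
    proof -
      have "luxemburg_norm \<Phi>1 u < ennreal (n1 / \<rho>)" "luxemburg_norm \<Phi>2 v < ennreal (n2 / \<rho>)"
        unfolding N using \<rho> 3 by (auto intro!: ennreal_lessI simp: field_simps)
      note a = luxemburg_norm_less_imp[OF y(1) this(1)] and b = luxemburg_norm_less_imp[OF y(2) this(2)]
      show ?thesis unfolding B
        by (rule luxemburg_norm_bilinear_average_le[OF y inv m L h T_def \<open>0 < T\<close> a b \<rho>])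
    qed
    have "((\<lambda>\<rho>. ennreal (2 * T * (n1 / \<rho>) * (n2 / \<rho>) / \<rho>\<^sup>2))
      \<longlongrightarrow> ennreal (2 * T * (n1 / 1) * (n2 / 1) / 1\<^sup>2)) (at_left 1)"
      by (intro tendsto_ennrealI tendsto_intros) auto
    moreover have "\<forall>\<^sub>F \<rho> in at_left (1::real). luxemburg_norm \<Phi>3 (bilinear_multiplier M f g)
      \<le> ennreal (2 * T * (n1 / \<rho>) * (n2 / \<rho>) / \<rho>\<^sup>2)"
      by (rule eventually_mono[OF eventually_at_left_real[of 0 "1::real"]]) (simp, rule bound, simp_all)
    ultimately have "luxemburg_norm \<Phi>3 (bilinear_multiplier M f g)
      \<le> ennreal (2 * T * (n1 / 1) * (n2 / 1) / 1\<^sup>2)"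
      by (intro tendsto_lowerbound) auto
    also have "\<dots> = ennreal (2 * T) * N1 * N2" using 3 by (simp add: ennreal_mult)
    also have "\<dots> \<le> ennreal C * N1 * N2"
      using C(2) by (intro mult_right_mono ennreal_leI) (auto simp: T_def)
    finally show ?thesis .
  qed
  then show "luxemburg_norm \<Phi>3 (bilinear_multiplier M f g)
    \<le> ennreal C * luxemburg_norm \<Phi>1 f * luxemburg_norm \<Phi>2 g"
    by (simp add: N1_def N2_def)
qed

text \<open>The transform of a finite measure is bounded and Borel.\<close>

lemma absolutely_integrable_on_fourier_transform:
  assumes L: "finite_measure L" "sets L = sets borel" and h: "integrable L h"
    and M: "\<And>\<xi>. M \<xi> = (LINT t|L. h t * cis (- 2 * pi * t * \<xi>))" and K: "compact K"
  shows "M absolutely_integrable_on K"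
proof -
  interpret L: finite_measure L by fact
  note L(2)[measurable_cong]
  have hm[measurable]: "h \<in> borel_measurable L" using h by auto
  have [measurable]: "M \<in> borel_measurable borel" unfolding M[abs_def] by measurable
  have [measurable]: "K \<in> sets borel" using K by (rule borel_compact)
  have b: "norm (M \<xi>) \<le> (LINT t|L. norm (h t))" for \<xi>
    using integral_norm_bound[of L "\<lambda>t. h t * cis (- 2 * pi * t * \<xi>)"] by (simp add: M norm_mult)
  have "integrable lborel (\<lambda>\<xi>. indicator K \<xi> *\<^sub>R (LINT t|L. norm (h t)))"
    using emeasure_compact_finite[OF K] by (intro integrable_scaleR_left integrable_real_indicator) auto
  then have "integrable lborel (\<lambda>\<xi>. indicator K \<xi> *\<^sub>R M \<xi>)"
    by (rule Bochner_Integration.integrable_bound) (auto split: split_indicator intro: order_trans[OF b])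
  then show ?thesis
    unfolding set_integrable_def by (subst integrable_completion) auto
qed

theorem theorem4p1:
  fixes \<Phi>1 \<Phi>2 \<Phi>3 :: "real \<Rightarrow> ennreal"
    and \<mu> :: "real set \<Rightarrow> complex"
    and M :: "real \<Rightarrow> complex"
  assumes "young_function \<Phi>1" and "young_function \<Phi>2" and "young_function \<Phi>3"
    and "\<And>x. 0 \<le> x \<Longrightarrow> young_inverse \<Phi>1 x * young_inverse \<Phi>2 x \<le> young_inverse \<Phi>3 x"
    and "regular_complex_measure \<mu>"
    and "\<And>\<xi>. M \<xi> = fourier_measure \<mu> \<xi>"
  shows "M \<in> multiplier_space \<Phi>1 \<Phi>2 \<Phi>3 \<and>
         multiplier_norm \<Phi>1 \<Phi>2 \<Phi>3 M \<le> 2 * total_variation \<mu> UNIV"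
proof -
  have sa: "sigma_additive \<mu>"
    using assms(5) unfolding regular_complex_measure_def sigma_additive_def by (rule conjunct1)
  obtain K where K: "\<And>A. A \<in> sets borel \<Longrightarrow> norm (\<mu> A) \<le> K"
    using regular_complex_measure_bounded[OF assms(5)] by blast
  obtain L :: "real measure" and h :: "real \<Rightarrow> complex"
    where L: "finite_measure L" "sets L = sets borel" and h: "integrable L h"
    and \<mu>: "\<And>A. A \<in> sets borel \<Longrightarrow> \<mu> A = (LINT x|L. indicator A x *\<^sub>R h x)"
    and int: "\<And>f B. f \<in> borel_measurable borel \<Longrightarrow> (\<And>x. norm (f x) \<le> B) \<Longrightarrow> complex_integral \<mu> f
      = (LINT x|L. h x * f x)"
    using complex_measure_density[OF sa K] by blast
  have M: "M \<xi> = (LINT t|L. h t * cis (- 2 * pi * t * \<xi>))" for \<xi>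
    unfolding assms(6) fourier_measure_def by (rule int[where B=1]) auto
  define T where "T = (LINT t|L. norm (h t))"
  have T0: "0 \<le> T" by (simp add: T_def)
  have "ennreal T = (\<integral>\<^sup>+t. ennreal (norm (h t)) \<partial>L)"
    unfolding T_def using h by (intro nn_integral_eq_integral[symmetric]) auto
  also have "\<dots> \<le> total_variation \<mu> UNIV"
    by (rule integral_norm_density_le_total_variation[OF L h \<mu>])
  finally have TV: "ennreal T \<le> total_variation \<mu> UNIV" .
  have bound: "multiplier_bound \<Phi>1 \<Phi>2 \<Phi>3 M C" if "0 < C" "2 * T \<le> C" for C
    by (rule multiplier_bound_fourier_transform[OF assms(1-4) L h M]) (use that in \<open>auto simp: T_def\<close>)
  have "multiplier_norm \<Phi>1 \<Phi>2 \<Phi>3 M \<le> ennreal (2 * T) + ennreal e" if "0 < e" for e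
  proof -
    have "multiplier_norm \<Phi>1 \<Phi>2 \<Phi>3 M \<le> ennreal (2 * T + e)"
      unfolding multiplier_norm_def using that T0 by (intro INF_lower) (auto intro!: bound)
    then show ?thesis using that T0 by simp
  qed
  then have "multiplier_norm \<Phi>1 \<Phi>2 \<Phi>3 M \<le> ennreal (2 * T)" by (rule ennreal_le_epsilon)
  also have "\<dots> = 2 * ennreal T" using T0 by (simp add: ennreal_mult)
  also have "\<dots> \<le> 2 * total_variation \<mu> UNIV" by (intro mult_left_mono TV) auto
  finally have "multiplier_norm \<Phi>1 \<Phi>2 \<Phi>3 M \<le> 2 * total_variation \<mu> UNIV" .
  moreover have "M \<in> multiplier_space \<Phi>1 \<Phi>2 \<Phi>3"
    unfolding multiplier_space_def
    using absolutely_integrable_on_fourier_transform[OF L h M] bound[of "2 * T + 1"] T0 by auto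
  ultimately show ?thesis by blast
qed

end
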